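(* Let $X$ be a locally compact second countable Hausdorff space, $\sigma : X \to X$ a local homeomorphism and $\phi : X \to \mathbb R$ a continuous function. Assume that $(X,\sigma)$ is cofinal and non-compact, and that $\mathbb P(-\phi) \leq 0$. Let $h \in C_c(X)$ be non-negative and non-zero. Then there is a $\phi$-conformal measure $m$ on $X$ such that $\int_X h \, dm = 1$.
   Context: $C_c(X)$ is the space of continuous compactly supported functions on $X$. Regular Borel measures are understood as in the Riesz representation theorem (non-negative, finite on compact sets). $(X,\sigma)$ is cofinal when $X = \bigcup_{i,j \in \mathbb N} \sigma^{-i}(\sigma^j(U))$ for every open non-empty $U \subseteq X$. $(X,\sigma)$ is non-compact when there is no open non-empty $U \subseteq X$ such that $\bigcup_{k=0}^{\infty} \sigma^k(U)$ has compact closure. A $\phi$-conformal measure is a regular non-zero Borel measure $m$ on $X$ such that $m(\sigma(A)) = \int_A e^{\phi(x)} \, dm(x)$ for every Borel subset $A \subseteq X$ on which $\sigma$ is injective. For a continuous $\psi : X \to \mathbb R$ the Ruelle operator $L_\psi : C_c(X) \to C_c(X)$ is $L_\psi(f)(x) = \sum_{y \in \sigma^{-1}(x)} e^{\psi(y)} f(y)$. When $(X,\sigma)$ is cofinal, the quantity $\mathbb P_x(\psi) = \log\left( \limsup_{n} \left(L_\psi^n(f)(x)\right)^{1/n}\right) \in [-\infty,\infty]$ (with $\log 0 = -\infty$, $\log\infty=\infty$) does not depend on the choice of non-negative non-zero $f \in C_c(X)$, and the pressure is $\mathbb P(\psi) = \sup_{x \in X} \mathbb P_x(\psi) \in [-\infty,\infty]$.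 *)

theory Defs
  imports "HOL-Analysis.Analysis"
begin

text \<open>The space \<open>X\<close> is a type \<open>'a\<close>; iterates are \<open>\<sigma> ^^ n\<close>, with \<open>n = 0\<close> included.\<close>

definition local_homeomorphism :: "('a::topological_space \<Rightarrow> 'b::topological_space) \<Rightarrow> bool" where
  "local_homeomorphism f \<longleftrightarrow>
     (\<forall>x. \<exists>U g. open U \<and> x \<in> U \<and> open (f ` U) \<and> homeomorphism U (f ` U) f g)"

definition cofinal_system :: "('a::topological_space \<Rightarrow> 'a) \<Rightarrow> bool" where
  "cofinal_system \<sigma> \<longleftrightarrow>
     (\<forall>U. open U \<and> U \<noteq> {} \<longrightarrow> (\<Union>i. \<Union>j. (\<sigma> ^^ i) -` ((\<sigma> ^^ j) ` U)) = UNIV)"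

definition noncompact_system :: "('a::topological_space \<Rightarrow> 'a) \<Rightarrow> bool" where
  "noncompact_system \<sigma> \<longleftrightarrow>
     \<not> (\<exists>U. open U \<and> U \<noteq> {} \<and> compact (closure (\<Union>k. (\<sigma> ^^ k) ` U)))"

definition Cc :: "('a::topological_space \<Rightarrow> real) set" where
  "Cc = {f. continuous_on UNIV f \<and> compact (closure (support_on UNIV f))}"

definition Cc_pos :: "('a::topological_space \<Rightarrow> real) set" where
  "Cc_pos = {f \<in> Cc. (\<forall>x. 0 \<le> f x) \<and> (\<exists>x. f x \<noteq> 0)}"

text \<open>The fibre may be infinite, hence \<open>infsum\<close>. When \<open>\<sigma>\<close> is a local homeomorphism and
  \<open>f \<in> Cc\<close>, only finitely many terms are non-zero.\<close>

definition ruelle :: "('a \<Rightarrow> 'a) \<Rightarrow> ('a \<Rightarrow> real) \<Rightarrow> ('a \<Rightarrow> real) \<Rightarrow> 'a \<Rightarrow> real" where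
  "ruelle \<sigma> \<psi> f x = (\<Sum>\<^sub>\<infinity>y\<in>\<sigma> -` {x}. exp (\<psi> y) * f y)"

definition ln_ext :: "ereal \<Rightarrow> ereal" where
  "ln_ext r = (if r \<le> 0 then -\<infinity> else if r = \<infinity> then \<infinity> else ereal (ln (real_of_ereal r)))"

definition ruelle_growth ::
    "('a \<Rightarrow> 'a) \<Rightarrow> ('a \<Rightarrow> real) \<Rightarrow> ('a \<Rightarrow> real) \<Rightarrow> 'a \<Rightarrow> ereal" where
  "ruelle_growth \<sigma> \<psi> f x =
     ln_ext (limsup (\<lambda>n. ereal (root n ((ruelle \<sigma> \<psi> ^^ n) f x))))"

text \<open>For a cofinal local homeomorphism of a locally compact Hausdorff space and a continuous
  \<open>\<psi>\<close>, the growth rate is the same for all \<open>f \<in> Cc_pos\<close>, and \<open>Cc_pos\<close> is not empty;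
  the description picks this common value. Outside that situation it may be unspecified.\<close>

definition pressure_at ::
    "('a::topological_space \<Rightarrow> 'a) \<Rightarrow> ('a \<Rightarrow> real) \<Rightarrow> 'a \<Rightarrow> ereal" where
  "pressure_at \<sigma> \<psi> x = (THE p. \<forall>f\<in>Cc_pos. ruelle_growth \<sigma> \<psi> f x = p)"

definition pressure :: "('a::topological_space \<Rightarrow> 'a) \<Rightarrow> ('a \<Rightarrow> real) \<Rightarrow> ereal" where
  "pressure \<sigma> \<psi> = (SUP x. pressure_at \<sigma> \<psi> x)"

definition regular_borel_measure :: "'a::topological_space measure \<Rightarrow> bool" where
  "regular_borel_measure m \<longleftrightarrow>
     sets m = sets borel \<and>
     (\<forall>K. compact K \<longrightarrow> emeasure m K < \<infinity>) \<and>
     (\<forall>A\<in>sets borel. emeasure m A = (INF U\<in>{U. open U \<and> A \<subseteq> U}. emeasure m U)) \<and>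
     (\<forall>U. open U \<longrightarrow> emeasure m U = (SUP K\<in>{K. compact K \<and> K \<subseteq> U}. emeasure m K))"

text \<open>\<open>emeasure\<close> is \<open>0\<close> on non-measurable sets; this plays no role here, since a local
  homeomorphism of a second countable space maps a Borel set to a Borel set.\<close>

definition conformal_measure ::
    "('a::topological_space \<Rightarrow> 'a) \<Rightarrow> ('a \<Rightarrow> real) \<Rightarrow> 'a measure \<Rightarrow> bool" where
  "conformal_measure \<sigma> \<phi> m \<longleftrightarrow>
     regular_borel_measure m \<and> emeasure m UNIV \<noteq> 0 \<and>
     (\<forall>A\<in>sets borel. inj_on \<sigma> A \<longrightarrow>
        emeasure m (\<sigma> ` A) = (\<integral>\<^sup>+x\<in>A. ennreal (exp (\<phi> x)) \<partial>m))"

end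

theory Submission
  imports Defs
begin

text \<open>
  Let \<open>L\<close> be the Ruelle operator of \<open>- \<phi>\<close>. By local inverses of \<open>\<sigma>\<close>, a regular measure \<open>m\<close> is
  \<open>\<phi>\<close>-conformal as soon as \<open>\<integral> L f dm = \<integral> f dm\<close> for all non-negative \<open>f \<in> C\<^sub>c\<close>, so by Riesz it is
  enough to find an \<open>L\<close>-invariant positive functional with value \<open>1\<close> at \<open>h\<close>. It is a cluster point of
  \<open>f \<mapsto> G\<^sub>t f x / G\<^sub>t h x\<close> with \<open>G\<^sub>t f = (\<Sum>n. t\<^sup>n L\<^sup>n f)\<close>. Since \<open>t G\<^sub>t (L f) = G\<^sub>t f - f\<close>, the
  limit is invariant when \<open>f x / G\<^sub>t h x\<close> tends to \<open>0\<close> and \<open>t\<close> to \<open>1\<close>; cofinality bounds the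
  quotients for each \<open>f\<close>. If \<open>G\<^sub>1 h x\<close> diverges for some \<open>x\<close>, fix this \<open>x\<close> and let \<open>t\<close> increase to
  \<open>1\<close>, the pressure bound giving convergence for \<open>t < 1\<close>. Otherwise take \<open>t = 1\<close> and let \<open>x\<close> leave
  all compact sets inside the forward orbit of \<open>{h > 0}\<close>, which non-compactness allows.
\<close>

section \<open>Compactly supported functions\<close>

definition csupp_in :: "('a::topological_space \<Rightarrow> real) \<Rightarrow> 'a set \<Rightarrow> bool" where
  "csupp_in f U \<longleftrightarrow> (\<exists>K. compact K \<and> K \<subseteq> U \<and> (\<forall>x. x \<notin> K \<longrightarrow> f x = 0))"

definition Cc_nonneg :: "('a::topological_space \<Rightarrow> real) set" where
  "Cc_nonneg = {f. continuous_on UNIV f \<and> (\<forall>x. 0 \<le> f x) \<and> csupp_in f UNIV}"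

lemma Cc_iff_csupp_in:
  fixes f :: "'a::t2_space \<Rightarrow> real"
  shows "f \<in> Cc \<longleftrightarrow> continuous_on UNIV f \<and> csupp_in f UNIV"
proof -
  have "compact (closure (support_on UNIV f)) \<longleftrightarrow> csupp_in f UNIV"
  proof
    assume "compact (closure (support_on UNIV f))"
    moreover have "x \<notin> closure (support_on UNIV f) \<longrightarrow> f x = 0" for x
      using closure_subset[of "support_on UNIV f"] by (auto simp: support_on_def)
    ultimately show "csupp_in f UNIV"
      unfolding csupp_in_def by blast
  next
    assume "csupp_in f UNIV"
    then obtain K where K: "compact K" "\<forall>x. x \<notin> K \<longrightarrow> f x = 0"
      unfolding csupp_in_def by blast
    then have "closure (support_on UNIV f) \<subseteq> K"
      by (intro closure_minimal compact_imp_closed) (auto simp: support_on_def)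
    then show "compact (closure (support_on UNIV f))"
      using K(1) by (metis closed_closure compact_Int_closed inf.absorb_iff2)
  qed
  then show ?thesis
    by (simp add: Cc_def)
qed

lemma Cc_nonneg_iff:
  fixes f :: "'a::t2_space \<Rightarrow> real"
  shows "f \<in> Cc_nonneg \<longleftrightarrow> f \<in> Cc \<and> (\<forall>x. 0 \<le> f x)"
  by (auto simp: Cc_nonneg_def Cc_iff_csupp_in)

lemma csupp_in_mono: "csupp_in f U \<Longrightarrow> U \<subseteq> V \<Longrightarrow> csupp_in f V"
  unfolding csupp_in_def by blast

lemma csupp_in_zero: "csupp_in f U \<Longrightarrow> x \<notin> U \<Longrightarrow> f x = 0"
  unfolding csupp_in_def by blast

lemma csupp_in_dominated:
  assumes "csupp_in f U" "\<And>x. f x = 0 \<Longrightarrow> g x = 0"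
  shows "csupp_in g U"
  using assms unfolding csupp_in_def by blast

lemma csupp_in_add:
  assumes "csupp_in f U" "csupp_in g U"
  shows "csupp_in (\<lambda>x. f x + g x) U"
proof -
  obtain K K' where "compact K" "K \<subseteq> U" "\<forall>x. x \<notin> K \<longrightarrow> f x = 0"
    "compact K'" "K' \<subseteq> U" "\<forall>x. x \<notin> K' \<longrightarrow> g x = 0"
    using assms unfolding csupp_in_def by metis
  then show ?thesis
    unfolding csupp_in_def by (intro exI[of _ "K \<union> K'"]) auto
qed

lemma Cc_nonnegD:
  assumes "f \<in> Cc_nonneg"
  shows "continuous_on UNIV f" "0 \<le> f x" "csupp_in f UNIV"
  using assms by (auto simp: Cc_nonneg_def)

lemma Cc_nonneg_zero: "(\<lambda>x. 0) \<in> Cc_nonneg"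
  unfolding Cc_nonneg_def csupp_in_def by (auto intro!: exI[of _ "{}"])

lemma Cc_nonneg_add:
  "f \<in> Cc_nonneg \<Longrightarrow> g \<in> Cc_nonneg \<Longrightarrow> (\<lambda>x. f x + g x) \<in> Cc_nonneg"
  unfolding Cc_nonneg_def by (auto intro!: continuous_intros csupp_in_add)

lemma Cc_nonneg_sum:
  assumes "\<And>i. i \<in> I \<Longrightarrow> f i \<in> Cc_nonneg"
  shows "(\<lambda>x. \<Sum>i\<in>I. f i x) \<in> Cc_nonneg"
  using assms
  by (induction I rule: infinite_finite_induct) (auto intro!: Cc_nonneg_add Cc_nonneg_zero)

lemma Cc_nonneg_dominated:
  assumes "f \<in> Cc_nonneg" "continuous_on UNIV g" "\<And>x. 0 \<le> g x" "\<And>x. f x = 0 \<Longrightarrow> g x = 0"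
  shows "g \<in> Cc_nonneg"
  using assms csupp_in_dominated[of f UNIV g] unfolding Cc_nonneg_def by auto

lemma Cc_nonneg_mult:
  assumes "f \<in> Cc_nonneg" "continuous_on UNIV g" "\<And>x. 0 \<le> g x"
  shows "(\<lambda>x. f x * g x) \<in> Cc_nonneg"
  by (rule Cc_nonneg_dominated[OF assms(1)])
    (use assms in \<open>auto intro!: continuous_intros simp: Cc_nonneg_def\<close>)

lemma Cc_nonneg_scale: "f \<in> Cc_nonneg \<Longrightarrow> 0 \<le> c \<Longrightarrow> (\<lambda>x. c * f x) \<in> Cc_nonneg"
  by (rule Cc_nonneg_dominated[of f]) (auto intro!: continuous_intros simp: Cc_nonneg_def)

lemma Cc_nonneg_diff:
  assumes "f \<in> Cc_nonneg" "g \<in> Cc_nonneg" "\<And>x. g x \<le> f x"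
  shows "(\<lambda>x. f x - g x) \<in> Cc_nonneg"
proof (rule Cc_nonneg_dominated[OF assms(1)])
  show "f x - g x = 0" if "f x = 0" for x
    using assms(3)[of x] Cc_nonnegD(2)[OF assms(2), of x] that by simp
qed (use assms in \<open>auto intro!: continuous_intros simp: Cc_nonneg_def\<close>)

lemma Cc_nonneg_bounded:
  assumes "f \<in> Cc_nonneg"
  obtains B where "0 < B" "\<And>x. f x \<le> B"
proof -
  obtain K where K: "compact K" "\<forall>x. x \<notin> K \<longrightarrow> f x = 0"
    using Cc_nonnegD(3)[OF assms] unfolding csupp_in_def by blast
  have "compact (f ` K)"
    using K(1) Cc_nonnegD(1)[OF assms] compact_continuous_image continuous_on_subset by blast
  then have "bounded (f ` K)"
    by (rule compact_imp_bounded)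
  then obtain B where B: "0 < B" "\<And>x. x \<in> K \<Longrightarrow> \<bar>f x\<bar> \<le> B"
    unfolding bounded_pos by auto
  have "f x \<le> B" for x
    using B(1) B(2)[of x] K(2) by (cases "x \<in> K") auto
  then show thesis using that B(1) by blast
qed

lemma Hausdorff_space_t2_space: "Hausdorff_space (euclidean :: 'a::t2_space topology)"
  unfolding Hausdorff_space_def using hausdorff[where ?'a = 'a]
  by (auto simp: disjnt_def)

lemma locally_compact_interpose:
  fixes K :: "'a::t2_space set"
  assumes lc: "locally_compact_space (euclidean :: 'a topology)"
    and "compact K" "open U" "K \<subseteq> U"
  obtains V K' where "open V" "compact K'" "K \<subseteq> V" "V \<subseteq> K'" "K' \<subseteq> U"
proof -
  have "\<exists>V K'. open V \<and> compact K' \<and> x \<in> V \<and> V \<subseteq> K' \<and> K' \<subseteq> U" if "x \<in> K" for x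
  proof -
    have "neighbourhood_base_of (compactin euclidean) (euclidean :: 'a topology)"
      by (rule locally_compact_imp_neighbourhood_base[OF lc
            locally_compact_Hausdorff_imp_regular_space[OF lc]])
         (simp add: Hausdorff_space_t2_space)
    then show ?thesis
      using that assms(3,4) unfolding neighbourhood_base_of by (auto 4 4 dest!: spec[of _ U])
  qed
  then obtain V K' where VK: "\<And>x. x \<in> K \<Longrightarrow> open (V x) \<and> compact (K' x) \<and> x \<in> V x \<and> V x \<subseteq> K' x \<and> K' x \<subseteq> U"
    by metis
  obtain D where D: "D \<subseteq> K" "finite D" "K \<subseteq> (\<Union>x\<in>D. V x)"
    using compactE_image[OF assms(2), of K V] VK by blast
  show thesis
  proof (rule that[of "\<Union>x\<in>D. V x" "\<Union>x\<in>D. K' x"])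
    show "open (\<Union>x\<in>D. V x)" "compact (\<Union>x\<in>D. K' x)" "K \<subseteq> (\<Union>x\<in>D. V x)"
      "(\<Union>x\<in>D. V x) \<subseteq> (\<Union>x\<in>D. K' x)" "(\<Union>x\<in>D. K' x) \<subseteq> U"
      using D VK by (auto intro!: compact_UN) blast+
  qed
qed

lemma Cc_urysohn:
  fixes K :: "'a::t2_space set"
  assumes lc: "locally_compact_space (euclidean :: 'a topology)"
    and "compact K" "open U" "K \<subseteq> U"
  obtains u V where "u \<in> Cc_nonneg" "\<And>x. u x \<le> 1" "csupp_in u U" "open V" "K \<subseteq> V"
    "\<And>x. x \<in> V \<Longrightarrow> u x = 1"
proof -
  obtain W K' where W: "open W" "compact K'" "K \<subseteq> W" "W \<subseteq> K'" "K' \<subseteq> U"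
    using locally_compact_interpose[OF assms] by metis
  have cr: "completely_regular_space (euclidean :: 'a topology)"
    by (rule locally_compact_regular_imp_completely_regular_space[OF lc])
      (simp add: Hausdorff_space_t2_space)
  have "\<exists>f::'a \<Rightarrow> real. continuous_on UNIV f \<and> f x = 1 \<and> (\<forall>y. y \<notin> W \<longrightarrow> f y = 0) \<and> (\<forall>y. 0 \<le> f y)"
    if "x \<in> K" for x
  proof -
    have "closedin euclidean (- W)" "x \<in> topspace euclidean - (- W)"
      using W(1,3) that by (auto simp: closed_Compl)
    then obtain f :: "'a \<Rightarrow> real" where "continuous_map euclidean (top_of_set {0..1}) f" "f x = 0" "f ` (- W) \<subseteq> {1}"
      using cr unfolding completely_regular_space_def by blast
    then show ?thesis
      by (intro exI[of _ "\<lambda>y. 1 - f y"])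
        (auto intro!: continuous_intros simp: continuous_map_in_subtopology image_subset_iff)
  qed
  then obtain F where F: "\<And>x. x \<in> K \<Longrightarrow> continuous_on UNIV (F x) \<and> F x x = 1 \<and> (\<forall>y. y \<notin> W \<longrightarrow> F x y = 0) \<and> (\<forall>y. (0::real) \<le> F x y)"
    by metis
  have Fo: "open {y. F x y > 1/2}" if "x \<in> K" for x
    using open_Collect_less[of "\<lambda>_. 1/2" "F x"] F[OF that] by simp
  have "K \<subseteq> (\<Union>x\<in>K. {y. F x y > 1/2})"
  proof
    fix x assume "x \<in> K"
    then have "F x x > 1/2" using F by simp
    then show "x \<in> (\<Union>x\<in>K. {y. F x y > 1/2})" using \<open>x \<in> K\<close> by blast
  qed
  then obtain D where D: "D \<subseteq> K" "finite D" "K \<subseteq> (\<Union>x\<in>D. {y. F x y > 1/2})"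
    using compactE_image[OF assms(2), of K "\<lambda>x. {y. F x y > 1/2}"] Fo by metis
  define s where "s y = (\<Sum>x\<in>D. F x y)" for y
  have s: "continuous_on UNIV s" "\<And>y. 0 \<le> s y" "\<And>y. y \<notin> W \<Longrightarrow> s y = 0"
    unfolding s_def using D(1) F by (auto intro!: continuous_intros sum_nonneg sum.neutral simp: subset_iff)
  have sK: "s y > 1/2" if y: "y \<in> K" for y
  proof -
    obtain x where x: "x \<in> D" "F x y > 1/2" using D(3) y by blast
    have "F x y \<le> s y"
      unfolding s_def by (rule member_le_sum) (use x D F in auto)
    then show ?thesis using x by simp
  qed
  let ?u = "\<lambda>y. min 1 (2 * s y)"
  have cs: "csupp_in ?u U"
  proof -
    have "?u x = 0" if "x \<notin> K'" for x
    proof -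
      have "x \<notin> W" using W(4) that by blast
      then show ?thesis using s(3) by simp
    qed
    then show ?thesis
      unfolding csupp_in_def using W by blast
  qed
  show thesis
  proof (rule that[of ?u "{y. s y > 1/2}"])
    show "?u \<in> Cc_nonneg"
      using s csupp_in_mono[OF cs] unfolding Cc_nonneg_def by (auto intro!: continuous_intros)
    show "open {y. s y > 1/2}"
      using s(1) by (intro open_Collect_less) auto
    show "K \<subseteq> {y. s y > 1/2}" using sK by blast
  qed (use cs in \<open>simp_all add: min_def\<close>)
qed

lemma Cc_nonneg_split2:
  fixes f :: "'a::t2_space \<Rightarrow> real"
  assumes lc: "locally_compact_space (euclidean :: 'a topology)"
    and f: "f \<in> Cc_nonneg" "csupp_in f (U \<union> V)" and "open U" "open V"
  obtains f1 f2 where "f1 \<in> Cc_nonneg" "csupp_in f1 U" "f2 \<in> Cc_nonneg" "csupp_in f2 V"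
    "\<And>x. f x = f1 x + f2 x"
proof -
  obtain K where K: "compact K" "K \<subseteq> U \<union> V" "\<forall>x. x \<notin> K \<longrightarrow> f x = 0"
    using f(2) unfolding csupp_in_def by blast
  have "compact (K - V)" "K - V \<subseteq> U"
    using K assms by (auto simp: compact_diff)
  then obtain u W where u: "u \<in> Cc_nonneg" "\<And>x. u x \<le> 1" "csupp_in u U" "open W" "K - V \<subseteq> W"
    "\<And>x. x \<in> W \<Longrightarrow> u x = 1"
    using Cc_urysohn[OF lc _ \<open>open U\<close>] by metis
  show thesis
  proof (rule that[of "\<lambda>x. f x * u x" "\<lambda>x. f x * (1 - u x)"])
    show "(\<lambda>x. f x * u x) \<in> Cc_nonneg" "(\<lambda>x. f x * (1 - u x)) \<in> Cc_nonneg"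
      using f(1) u(1,2) by (auto intro!: Cc_nonneg_mult continuous_intros simp: Cc_nonnegD)
    show "csupp_in (\<lambda>x. f x * u x) U"
      by (rule csupp_in_dominated[OF u(3)]) auto
    have "compact (K - W)" "K - W \<subseteq> V"
      using K u by (auto simp: compact_diff)
    then show "csupp_in (\<lambda>x. f x * (1 - u x)) V"
      unfolding csupp_in_def using K(3) u(6) by (intro exI[of _ "K - W"]) auto
  qed (simp add: algebra_simps)
qed

lemma Cc_nonneg_split:
  fixes f :: "'a::t2_space \<Rightarrow> real"
  assumes lc: "locally_compact_space (euclidean :: 'a topology)"
    and "f \<in> Cc_nonneg" "csupp_in f (\<Union>i\<in>I. U i)" "finite I" "\<And>i. i \<in> I \<Longrightarrow> open (U i)"
  shows "\<exists>F. (\<forall>i\<in>I. F i \<in> Cc_nonneg \<and> csupp_in (F i) (U i)) \<and> (\<forall>x. f x = (\<Sum>i\<in>I. F i x))"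
  using assms(4,2,3,5)
proof (induction I arbitrary: f rule: finite_induct)
  case empty
  then show ?case by (auto simp: csupp_in_zero)
next
  case (insert j I)
  have UI: "csupp_in f (U j \<union> (\<Union>i\<in>I. U i))" "open (U j)" "open (\<Union>i\<in>I. U i)"
    using insert.prems by auto
  obtain f1 f2 where f12: "f1 \<in> Cc_nonneg" "csupp_in f1 (U j)" "f2 \<in> Cc_nonneg"
    "csupp_in f2 (\<Union>i\<in>I. U i)" "\<And>x. f x = f1 x + f2 x"
    using Cc_nonneg_split2[OF lc insert.prems(1) UI] by metis
  obtain F where F: "\<forall>i\<in>I. F i \<in> Cc_nonneg \<and> csupp_in (F i) (U i)" "\<forall>x. f2 x = (\<Sum>i\<in>I. F i x)"
    using insert.IH[OF f12(3,4)] insert.prems by auto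
  have "(\<Sum>i\<in>I. (F(j := f1)) i x) = (\<Sum>i\<in>I. F i x)" for x
    using insert.hyps by (intro sum.cong) auto
  then show ?case
    using insert.hyps F f12 by (intro exI[of _ "F(j := f1)"]) auto
qed

lemma Cc_nonneg_split_cover:
  fixes f :: "'a::t2_space \<Rightarrow> real"
  assumes lc: "locally_compact_space (euclidean :: 'a topology)"
    and f: "f \<in> Cc_nonneg" "csupp_in f (\<Union>i\<in>I. U i)" and U: "\<And>i. i \<in> I \<Longrightarrow> open (U i)"
  obtains J F where "finite J" "J \<subseteq> I" "\<And>i. i \<in> J \<Longrightarrow> F i \<in> Cc_nonneg"
    "\<And>i. i \<in> J \<Longrightarrow> csupp_in (F i) (U i)" "\<And>x. f x = (\<Sum>i\<in>J. F i x)"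
proof -
  obtain K where K: "compact K" "K \<subseteq> (\<Union>i\<in>I. U i)" "\<forall>x. x \<notin> K \<longrightarrow> f x = 0"
    using f(2) unfolding csupp_in_def by blast
  obtain J where J: "J \<subseteq> I" "finite J" "K \<subseteq> (\<Union>i\<in>J. U i)"
    using compactE_image[OF K(1), of I U] K(2) U by blast
  then have "csupp_in f (\<Union>i\<in>J. U i)"
    using K unfolding csupp_in_def by blast
  then show thesis
    using Cc_nonneg_split[OF lc f(1) _ J(2), of U] J(1) U that[OF J(2,1)] by blast
qed

lemma Cc_nonneg_transport:
  fixes f :: "'a::t2_space \<Rightarrow> real" and p :: "'a \<Rightarrow> 'b::t2_space"
  assumes V: "open V" and hom: "homeomorphism U V p q"
    and f: "f \<in> Cc_nonneg" "csupp_in f U"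
  shows "(\<lambda>x. if x \<in> V then f (q x) else 0) \<in> Cc_nonneg" (is "?F \<in> _")
proof -
  obtain K where K: "compact K" "K \<subseteq> U" "\<forall>x. x \<notin> K \<longrightarrow> f x = 0"
    using f(2) unfolding csupp_in_def by blast
  have pK: "compact (p ` K)"
    using compact_continuous_image[OF continuous_on_subset[OF homeomorphism_cont1[OF hom] K(2)] K(1)] .
  have z: "?F x = 0" if "x \<notin> p ` K" for x
  proof (cases "x \<in> V")
    case True
    then have "p (q x) = x" using homeomorphism_apply2[OF hom] by simp
    then have "q x \<notin> K" using that by (metis image_eqI)
    then show ?thesis using K(3) by simp
  qed simp
  have "continuous_on (V \<union> - (p ` K)) ?F"
  proof (rule continuous_on_open_Un)
    show "open (- (p ` K))" using pK compact_imp_closed by blast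
    have "continuous_on V (\<lambda>x. f (q x))"
      by (rule continuous_on_compose2[OF Cc_nonnegD(1)[OF f(1)] homeomorphism_cont2[OF hom] subset_UNIV])
    then show "continuous_on V ?F"
      by (rule continuous_on_eq) simp
    show "continuous_on (- (p ` K)) ?F"
      by (rule continuous_on_eq[OF continuous_on_const[of _ 0]]) (metis ComplD z)
  qed (rule V)
  moreover have "V \<union> - (p ` K) = UNIV"
    using K(2) homeomorphism_image1[OF hom] by blast
  ultimately have "continuous_on UNIV ?F" by simp
  moreover have "csupp_in ?F UNIV"
    unfolding csupp_in_def using pK z by blast
  ultimately show ?thesis
    unfolding Cc_nonneg_def using Cc_nonnegD(2)[OF f(1)] by auto
qed

lemma countable_subcover_nat:
  fixes U :: "'a::second_countable_topology \<Rightarrow> 'a set"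
  assumes "\<And>x. open (U x)" "\<And>x. x \<in> U x"
  obtains e :: "nat \<Rightarrow> 'a" where "(\<Union>n. U (e n)) = UNIV"
proof -
  obtain F where F: "F \<subseteq> range U" "countable F" "\<Union>F = \<Union>(range U)"
    using Lindelof[of "range U"] assms(1) by blast
  have UF: "\<Union>F = UNIV" using F(3) assms(2) by blast
  then have "F \<noteq> {}" by blast
  then have "range (from_nat_into F) = F"
    using F(2) by (rule range_from_nat_into)
  then have "\<exists>x. from_nat_into F n = U x" for n
    using F(1) by (metis imageE rangeI subsetD)
  then obtain e where e: "\<And>n. from_nat_into F n = U (e n)" by metis
  have "(\<Union>n. U (e n)) = \<Union>(range (from_nat_into F))"
    unfolding e[symmetric] ..
  then show thesis
    using that UF \<open>range (from_nat_into F) = F\<close> by simp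
qed

lemma countable_precompact_cover:
  assumes lc: "locally_compact_space (euclidean :: 'a topology)"
  obtains N K :: "nat \<Rightarrow> 'a::{t2_space, second_countable_topology} set"
  where "\<And>n. open (N n)" "\<And>n. compact (K n)" "\<And>n. N n \<subseteq> K n" "(\<Union>n. N n) = UNIV"
proof -
  have "\<exists>V K. open V \<and> compact K \<and> {x} \<subseteq> V \<and> V \<subseteq> K" for x :: 'a
    using locally_compact_interpose[OF lc, of "{x}" UNIV] by (metis compact_sing open_UNIV subset_UNIV)
  then obtain N K where N: "\<And>x::'a. open (N x)" "\<And>x. compact (K x)" "\<And>x. {x} \<subseteq> N x" "\<And>x. N x \<subseteq> K x"
    by metis
  then have N': "\<And>x. x \<in> N x" by blast
  obtain e :: "nat \<Rightarrow> 'a" where e: "(\<Union>n. N (e n)) = UNIV"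
    by (rule countable_subcover_nat[OF N(1) N'])
  show thesis
    by (rule that[of "\<lambda>n. N (e n)" "\<lambda>n. K (e n)"]) (use N e in simp_all)
qed

lemma compact_exhaustion:
  assumes lc: "locally_compact_space (euclidean :: 'a topology)"
  obtains Q :: "nat \<Rightarrow> 'a::{t2_space, second_countable_topology} set"
  where "\<And>n. compact (Q n)" "incseq Q" "\<And>K. compact K \<Longrightarrow> \<exists>n. K \<subseteq> Q n"
proof -
  obtain N K :: "nat \<Rightarrow> 'a set" where N: "\<And>n. open (N n)" "\<And>n. compact (K n)" "\<And>n. N n \<subseteq> K n"
    and cover: "(\<Union>n. N n) = UNIV"
    by (rule countable_precompact_cover[OF lc]) (rule that; (assumption | blast))
  show thesis
  proof (rule that[of "\<lambda>n. \<Union>i\<le>n. K i"])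
    show "compact (\<Union>i\<le>n. K i)" for n
      using N(2) by (intro compact_UN) auto
    show "incseq (\<lambda>n. \<Union>i\<le>n. K i)"
      by (intro monoI UN_mono) auto
    fix C :: "'a set" assume C: "compact C"
    have cov: "C \<subseteq> (\<Union>n\<in>UNIV. N n)" using cover by simp
    obtain D where D: "D \<subseteq> UNIV" "finite D" "C \<subseteq> (\<Union>n\<in>D. N n)"
      by (rule compactE_image[OF C N(1) cov])
    have "D \<subseteq> {..Max (insert 0 D)}"
      using D(2) by auto
    then have "(\<Union>n\<in>D. N n) \<subseteq> (\<Union>i\<le>Max (insert 0 D). K i)"
      using N(3) by (intro UN_mono)
    with D(3) have "C \<subseteq> (\<Union>i\<le>Max (insert 0 D). K i)"
      by (rule subset_trans)
    then show "\<exists>n. C \<subseteq> (\<Union>i\<le>n. K i)"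
      by (rule exI)
  qed
qed

section \<open>The Riesz representation theorem\<close>

definition compact_content :: "(('a::topological_space \<Rightarrow> real) \<Rightarrow> real) \<Rightarrow> ('a set \<Rightarrow> real) \<Rightarrow> bool" where
  "compact_content T c \<longleftrightarrow> (\<forall>g\<in>Cc_nonneg. \<forall>K. compact K \<longrightarrow>
     ((\<forall>x. g x \<le> 1) \<and> (\<forall>x. x \<notin> K \<longrightarrow> g x = 0) \<longrightarrow> T g \<le> c K) \<and>
     ((\<forall>x\<in>K. 1 \<le> g x) \<longrightarrow> c K \<le> T g))"

locale positive_functional =
  fixes T :: "('a::t2_space \<Rightarrow> real) \<Rightarrow> real"
  assumes nonneg: "f \<in> Cc_nonneg \<Longrightarrow> 0 \<le> T f"
    and add: "f \<in> Cc_nonneg \<Longrightarrow> g \<in> Cc_nonneg \<Longrightarrow> T (\<lambda>x. f x + g x) = T f + T g"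
    and scale: "f \<in> Cc_nonneg \<Longrightarrow> 0 \<le> c \<Longrightarrow> T (\<lambda>x. c * f x) = c * T f"
begin

lemma mono:
  assumes "f \<in> Cc_nonneg" "g \<in> Cc_nonneg" "\<And>x. f x \<le> g x"
  shows "T f \<le> T g"
proof -
  have d: "(\<lambda>x. g x - f x) \<in> Cc_nonneg"
    using assms by (intro Cc_nonneg_diff)
  have "T g = T (\<lambda>x. f x + (g x - f x))"
    by simp
  also have "\<dots> = T f + T (\<lambda>x. g x - f x)"
    by (rule add[OF assms(1) d])
  finally show ?thesis
    using nonneg[OF d] by simp
qed

lemma zero: "T (\<lambda>x. 0) = 0"
  using scale[OF Cc_nonneg_zero, of 0] by simp

lemma sum:
  assumes "\<And>i. i \<in> I \<Longrightarrow> f i \<in> Cc_nonneg"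
  shows "T (\<lambda>x. \<Sum>i\<in>I. f i x) = (\<Sum>i\<in>I. T (f i))"
  using assms
proof (induction I rule: infinite_finite_induct)
  case (insert i I)
  then show ?case
    by (simp add: add Cc_nonneg_sum)
qed (simp_all add: zero)

lemma layer_bounds:
  fixes c :: "'a set \<Rightarrow> real"
  assumes c: "compact_content T c"
    and f: "f \<in> Cc_nonneg" and K: "compact K" "\<And>x. x \<notin> K \<Longrightarrow> f x = 0"
    and e: "0 < e" and N: "\<And>x. f x \<le> real N * e"
  shows "e * (\<Sum>k<N. c {x\<in>K. real (Suc k) * e \<le> f x}) \<le> T f"
    and "T f \<le> e * (\<Sum>k<N. c {x\<in>K. real k * e \<le> f x})"
proof -
  define g where "g k x = min (max (f x / e - real k) 0) 1" for k x
  have g: "g k \<in> Cc_nonneg" for k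
    unfolding g_def
    by (rule Cc_nonneg_dominated[OF f])
      (use e Cc_nonnegD[OF f] in \<open>auto intro!: continuous_intros\<close>)
  have sums: "(\<Sum>k<n. g k x) = min (f x / e) (real n)" for n x
  proof (induction n)
    case 0
    show ?case using e Cc_nonnegD(2)[OF f, of x] by simp
  next
    case (Suc n)
    then show ?case by (auto simp: g_def min_def max_def)
  qed
  have "f = (\<lambda>x. e * (\<Sum>k<N. g k x))"
    using e N by (auto simp: sums min_def field_simps)
  then have "T f = e * T (\<lambda>x. \<Sum>k<N. g k x)"
    using scale[of "\<lambda>x. \<Sum>k<N. g k x" e] e g by (metis Cc_nonneg_sum less_imp_le)
  also have "\<dots> = e * (\<Sum>k<N. T (g k))"
    using sum[of "{..<N}" g] g by simp
  finally have Tf: "T f = e * (\<Sum>k<N. T (g k))" .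
  have Kc: "compact {x\<in>K. a \<le> f x}" for a
  proof -
    have "closed {x. a \<le> f x}"
      using Cc_nonnegD(1)[OF f] by (intro closed_Collect_le) auto
    then have "compact (K \<inter> {x. a \<le> f x})"
      using K(1) by blast
    then show ?thesis by (simp add: Collect_conj_eq)
  qed
  have "c {x\<in>K. real (Suc k) * e \<le> f x} \<le> T (g k)" for k
  proof -
    have "1 \<le> g k x" if "real (Suc k) * e \<le> f x" for x
      using that e by (simp add: g_def field_simps)
    then show ?thesis
      using c g Kc unfolding compact_content_def by blast
  qed
  then show "e * (\<Sum>k<N. c {x\<in>K. real (Suc k) * e \<le> f x}) \<le> T f"
    unfolding Tf using e by (intro mult_left_mono sum_mono) auto
  have "T (g k) \<le> c {x\<in>K. real k * e \<le> f x}" for k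
  proof -
    have "g k x = 0" if "x \<notin> {x\<in>K. real k * e \<le> f x}" for x
    proof -
      have "f x / e - real k \<le> 0"
        using that e K(2)[of x] by (cases "x \<in> K") (auto simp: field_simps)
      then show ?thesis
        by (simp add: g_def)
    qed
    moreover have "g k x \<le> 1" for x
      by (simp add: g_def)
    ultimately show ?thesis
      using c g Kc unfolding compact_content_def by blast
  qed
  then show "T f \<le> e * (\<Sum>k<N. c {x\<in>K. real k * e \<le> f x})"
    unfolding Tf using e by (intro mult_left_mono sum_mono) auto
qed

end

text \<open>Slicing \<open>f\<close> into layers of height \<open>e\<close> pins the value of either functional down up to
  \<open>e * c K\<close>, where \<open>K\<close> carries \<open>f\<close>.\<close>

lemma positive_functional_eqI:
  fixes S T :: "('a::t2_space \<Rightarrow> real) \<Rightarrow> real" and c :: "'a set \<Rightarrow> real"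
  assumes S: "positive_functional S" and T: "positive_functional T"
    and c: "compact_content S c" "compact_content T c" "\<And>K. 0 \<le> c K"
    and f: "f \<in> Cc_nonneg"
  shows "S f = T f"
proof -
  obtain K where K: "compact K" "\<And>x. x \<notin> K \<Longrightarrow> f x = 0"
    using Cc_nonnegD(3)[OF f] unfolding csupp_in_def by blast
  obtain B where B: "0 < B" "\<And>x. f x \<le> B"
    using Cc_nonneg_bounded[OF f] by blast
  have bound: "\<bar>S f - T f\<bar> \<le> B * inverse (real (Suc n)) * c K" for n
  proof -
    define e where "e = B * inverse (real (Suc n))"
    have eB: "real (Suc n) * e = B"
      by (simp add: e_def del: of_nat_Suc)
    have e: "0 < e" "f x \<le> real (Suc n) * e" for x
      unfolding eB using B by (simp_all add: e_def)
    define C where "C k = c {x\<in>K. real k * e \<le> f x}" for k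
    have C0: "C 0 = c K"
      using Cc_nonnegD(2)[OF f] by (simp add: C_def)
    have "(\<Sum>k<Suc n. C k) = C 0 + (\<Sum>k<Suc n. C (Suc k)) - C (Suc n)"
      using sum.lessThan_Suc_shift[of C n] by simp
    then have "(\<Sum>k<Suc n. C k) - (\<Sum>k<Suc n. C (Suc k)) \<le> c K"
      using c(3)[of "{x\<in>K. real (Suc n) * e \<le> f x}"] C0 by (simp add: C_def)
    then have "e * (\<Sum>k<Suc n. C k) - e * (\<Sum>k<Suc n. C (Suc k)) \<le> e * c K"
      using e(1) by (metis mult_left_mono less_imp_le right_diff_distrib)
    moreover note positive_functional.layer_bounds[OF S c(1) f K e]
      positive_functional.layer_bounds[OF T c(2) f K e]
    ultimately show ?thesis
      unfolding e_def[symmetric] C_def by linarith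
  qed
  have "(\<lambda>n. B * inverse (real (Suc n)) * c K) \<longlonglongrightarrow> B * 0 * c K"
    by (intro tendsto_mult tendsto_const LIMSEQ_inverse_real_of_nat)
  then have "\<bar>S f - T f\<bar> \<le> B * 0 * c K"
    by (rule LIMSEQ_le_const) (use bound in blast)
  then show ?thesis by simp
qed

context positive_functional
begin

definition content :: "'a set \<Rightarrow> ennreal" where
  "content U = (SUP f\<in>{f\<in>Cc_nonneg. (\<forall>x. f x \<le> 1) \<and> csupp_in f U}. ennreal (T f))"

definition outer :: "'a set \<Rightarrow> ennreal" where
  "outer A = (INF U\<in>{U. open U \<and> A \<subseteq> U}. content U)"

lemma content_upper:
  "f \<in> Cc_nonneg \<Longrightarrow> (\<And>x. f x \<le> 1) \<Longrightarrow> csupp_in f U \<Longrightarrow> ennreal (T f) \<le> content U"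
  unfolding content_def by (rule SUP_upper) auto

lemma content_mono: "U \<subseteq> V \<Longrightarrow> content U \<le> content V"
  unfolding content_def by (rule SUP_subset_mono) (auto intro: csupp_in_mono)

lemma outer_open: "open U \<Longrightarrow> outer U = content U"
  unfolding outer_def by (rule antisym) (auto intro!: INF_lower INF_greatest content_mono)

lemma outer_mono: "A \<subseteq> B \<Longrightarrow> outer A \<le> outer B"
  unfolding outer_def by (rule INF_superset_mono) auto

lemma content_empty: "content {} = 0"
proof -
  have "ennreal (T f) = 0" if "f \<in> Cc_nonneg" "csupp_in f {}" for f
  proof -
    have "f = (\<lambda>x. 0)" using csupp_in_zero[OF that(2)] by auto
    then show ?thesis by (simp add: zero)
  qed
  then show ?thesis
    unfolding content_def by (intro antisym SUP_least) auto
qed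

lemma content_UN:
  assumes lc: "locally_compact_space (euclidean :: 'a topology)"
    and U: "\<And>n::nat. open (U n)"
  shows "content (\<Union>n. U n) \<le> (\<Sum>n. content (U n))"
  unfolding content_def[of "\<Union>n. U n"]
proof (rule SUP_least, clarify)
  fix f assume f: "f \<in> Cc_nonneg" "\<forall>x. f x \<le> 1" "csupp_in f (\<Union>n. U n)"
  obtain J F where JF: "finite J" "\<And>i. i \<in> J \<Longrightarrow> F i \<in> Cc_nonneg"
    "\<And>i. i \<in> J \<Longrightarrow> csupp_in (F i) (U i)" "\<And>x. f x = (\<Sum>i\<in>J. F i x)"
    using Cc_nonneg_split_cover[OF lc f(1,3) U] by (metis (no_types))
  have F1: "F i x \<le> 1" if "i \<in> J" for i x
  proof -
    have "F i x \<le> f x"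
      unfolding JF(4) using that JF(1,2) Cc_nonnegD(2) by (intro member_le_sum) auto
    then show ?thesis using f(2) by (meson order_trans)
  qed
  have "f = (\<lambda>x. \<Sum>i\<in>J. F i x)" using JF(4) by auto
  then have "ennreal (T f) = (\<Sum>i\<in>J. ennreal (T (F i)))"
    using sum[of J F] JF(2) nonneg by (simp add: sum_ennreal)
  also have "\<dots> \<le> (\<Sum>i\<in>J. content (U i))"
    using JF F1 by (intro sum_mono content_upper) auto
  also have "\<dots> \<le> (\<Sum>n. content (U n))"
    using JF(1) by (intro sum_le_suminf) auto
  finally show "ennreal (T f) \<le> (\<Sum>n. content (U n))" .
qed

lemma outer_measure_space_outer:
  assumes lc: "locally_compact_space (euclidean :: 'a topology)"
  shows "outer_measure_space UNIV outer"
  unfolding outer_measure_space_def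
proof (intro conjI)
  show "positive UNIV outer"
    unfolding positive_def using outer_open[of "{}"] content_empty by simp
  show "increasing UNIV outer"
    unfolding increasing_def by (auto intro: outer_mono)
  show "countably_subadditive UNIV outer"
    unfolding countably_subadditive_def
  proof (intro allI impI)
    fix A :: "nat \<Rightarrow> 'a set"
    show "outer (\<Union>i. A i) \<le> (\<Sum>i. outer (A i))"
    proof (rule ennreal_le_epsilon)
      fix e :: real assume fin: "(\<Sum>i. outer (A i)) < top" and e: "0 < e"
      have "\<exists>U. open U \<and> A i \<subseteq> U \<and> content U \<le> outer (A i) + ennreal (e * (1/2) ^ Suc i)" for i
      proof -
        have ltop: "outer (A i) < top"
        proof -
          have "outer (A i) \<le> (\<Sum>i. outer (A i))"
            using sum_le_suminf[of "\<lambda>i. outer (A i)" "{i}"] by simp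
          then show ?thesis using fin by (rule le_less_trans)
        qed
        have "0 < ennreal (e * (1/2) ^ Suc i)"
          using e by simp
        then have "outer (A i) < outer (A i) + ennreal (e * (1/2) ^ Suc i)"
          using ltop by (simp add: ennreal_add_left_cancel_less[of _ 0, simplified])
        then show ?thesis
          unfolding outer_def[of "A i"] INF_less_iff by (auto intro: less_imp_le)
      qed
      then obtain U where U: "\<And>i. open (U i)" "\<And>i. A i \<subseteq> U i"
        "\<And>i. content (U i) \<le> outer (A i) + ennreal (e * (1/2) ^ Suc i)"
        by metis
      have "outer (\<Union>i. A i) \<le> outer (\<Union>i. U i)"
        using U(2) by (intro outer_mono) blast
      also have "\<dots> = content (\<Union>i. U i)"
        using U(1) by (intro outer_open) auto
      also have "\<dots> \<le> (\<Sum>i. content (U i))"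
        by (rule content_UN[OF lc U(1)])
      also have "\<dots> \<le> (\<Sum>i. outer (A i) + ennreal (e * (1/2) ^ Suc i))"
        using U(3) by (intro suminf_le) auto
      also have "\<dots> = (\<Sum>i. outer (A i)) + (\<Sum>i. ennreal (e * (1/2) ^ Suc i))"
        by (rule suminf_add[symmetric]) auto
      also have "(\<Sum>i. ennreal (e * (1/2) ^ Suc i)) = ennreal e"
      proof (rule suminf_ennreal_eq)
        show "(\<lambda>i. e * (1/2) ^ Suc i) sums e"
          using sums_mult[OF power_half_series, of e] by simp
      qed (use e in auto)
      finally show "outer (\<Union>i. A i) \<le> (\<Sum>i. outer (A i)) + ennreal e" .
    qed
  qed
qed

lemma outer_measurable_open:
  assumes lc: "locally_compact_space (euclidean :: 'a topology)" and U: "open U"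
  shows "outer (A \<inter> U) + outer (A - U) \<le> outer A"
proof -
  have "outer (A \<inter> U) + outer (A - U) \<le> content W" if W: "open W" "A \<subseteq> W" for W
  proof -
    have bd: "ennreal (T f) + outer (W - U) \<le> content W"
      if f: "f \<in> Cc_nonneg" "\<forall>x. f x \<le> 1" "csupp_in f (W \<inter> U)" for f
    proof -
      obtain K where K: "compact K" "K \<subseteq> W \<inter> U" "\<forall>x. x \<notin> K \<longrightarrow> f x = 0"
        using f(3) unfolding csupp_in_def by blast
      have Ko: "open (W - K)"
        using W K(1) by (intro open_Diff compact_imp_closed)
      have "outer (W - U) \<le> content (W - K)"
        unfolding outer_open[OF Ko, symmetric] using K(2) by (intro outer_mono) blast
      moreover have "ennreal (T f) + content (W - K) \<le> content W"
        unfolding content_def[of "W - K"]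
      proof (subst ennreal_SUP_add_right)
        show "{g \<in> Cc_nonneg. (\<forall>x. g x \<le> 1) \<and> csupp_in g (W - K)} \<noteq> {}"
          using Cc_nonneg_zero by (force simp: csupp_in_def)
        show "(SUP g\<in>{g \<in> Cc_nonneg. (\<forall>x. g x \<le> 1) \<and> csupp_in g (W - K)}.
            ennreal (T f) + ennreal (T g)) \<le> content W"
        proof (rule SUP_least, clarify)
          fix g assume g: "g \<in> Cc_nonneg" "\<forall>x. g x \<le> 1" "csupp_in g (W - K)"
          have "csupp_in f W" "csupp_in g W"
            using csupp_in_mono f(3) g(3) by blast+
          then have "csupp_in (\<lambda>x. f x + g x) W"
            by (rule csupp_in_add)
          moreover have "f x + g x \<le> 1" for x
            using f(2) g(2) K(3) csupp_in_zero[OF g(3), of x] by (cases "x \<in> K") auto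
          ultimately have "ennreal (T (\<lambda>x. f x + g x)) \<le> content W"
            using f(1) g(1) by (intro content_upper Cc_nonneg_add)
          then show "ennreal (T f) + ennreal (T g) \<le> content W"
            using f(1) g(1) nonneg by (simp add: add)
        qed
      qed
      ultimately show ?thesis
        by (meson add_left_mono order_trans)
    qed
    have "content (W \<inter> U) + outer (W - U) \<le> content W"
      unfolding content_def[of "W \<inter> U"]
    proof (subst ennreal_SUP_add_left[symmetric])
      show "{f \<in> Cc_nonneg. (\<forall>x. f x \<le> 1) \<and> csupp_in f (W \<inter> U)} \<noteq> {}"
        using Cc_nonneg_zero by (force simp: csupp_in_def)
    qed (use bd in \<open>auto intro!: SUP_least\<close>)
    moreover have "outer (A \<inter> U) \<le> content (W \<inter> U)"
      using W U unfolding outer_def by (intro INF_lower) auto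
    moreover have "outer (A - U) \<le> outer (W - U)"
      using W by (intro outer_mono) auto
    ultimately show ?thesis
      by (meson add_mono order_trans)
  qed
  then show ?thesis
    unfolding outer_def[of A] by (intro INF_greatest) auto
qed

lemma measure_space_outer:
  assumes lc: "locally_compact_space (euclidean :: 'a topology)"
  shows "measure_space UNIV (sets borel) outer"
proof -
  let ?L = "lambda_system UNIV UNIV outer"
  have om: "outer_measure_space (Pow UNIV) outer"
    using outer_measure_space_outer[OF lc] by simp
  have ms: "measure_space UNIV ?L outer"
    using sigma_algebra.caratheodory_lemma[OF sigma_algebra_Pow om] by simp
  then have sa: "sigma_algebra UNIV ?L"
    by (simp add: measure_space_def)
  have "U \<in> ?L" if "open U" for U
  proof -
    have "outer (U \<inter> A) + outer ((UNIV - U) \<inter> A) = outer A" for A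
    proof (rule antisym)
      show "outer (U \<inter> A) + outer ((UNIV - U) \<inter> A) \<le> outer A"
      proof -
        have "U \<inter> A = A \<inter> U" "(UNIV - U) \<inter> A = A - U"
          by blast+
        then show ?thesis
          using outer_measurable_open[OF lc that, of A] by simp
      qed
      have sa: "subadditive UNIV outer"
        using ring_of_sets.countably_subadditive_subadditive[OF ring_of_sets_Pow, of UNIV outer] om
        by (simp add: outer_measure_space_def)
      have "outer A = outer ((U \<inter> A) \<union> ((UNIV - U) \<inter> A))"
        by (rule arg_cong[where f=outer]) blast
      also have "\<dots> \<le> outer (U \<inter> A) + outer ((UNIV - U) \<inter> A)"
        by (rule subadditiveD[OF sa]) auto
      finally show "outer A \<le> outer (U \<inter> A) + outer ((UNIV - U) \<inter> A)" .
    qed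
    then show ?thesis
      by (simp add: lambda_system_def)
  qed
  then have "sigma_sets UNIV {U. open U} \<subseteq> ?L"
    by (intro sigma_algebra.sigma_sets_subset[OF sa] subsetI) simp
  then have sub: "sets borel \<subseteq> ?L"
    by (simp add: borel_def)
  show ?thesis
  proof (rule measure_down[OF ms _ sub])
    show "sigma_algebra UNIV (sets borel :: 'a set set)"
      using sets.sigma_algebra_axioms[of "borel :: 'a measure"] by (simp only: space_borel)
  qed
qed

lemma outer_compact_le:
  assumes g: "g \<in> Cc_nonneg" and K: "compact K" "\<And>x. x \<in> K \<Longrightarrow> 1 \<le> g x"
  shows "outer K \<le> ennreal (T g)"
proof -
  have "outer K \<le> ennreal ((1 + inverse (real (Suc n))) * T g)" for n
  proof -
    define r where "r = 1 + inverse (real (Suc n))"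
    have r: "1 < r" by (simp add: r_def)
    have "open {x. 1 < r * g x}"
      using Cc_nonnegD(1)[OF g] by (intro open_Collect_less continuous_intros)
    moreover have "K \<subseteq> {x. 1 < r * g x}"
    proof
      fix x assume "x \<in> K"
      then have "r * 1 \<le> r * g x" using K(2) r by (intro mult_left_mono) auto
      then have "1 < r * g x" using r by linarith
      then show "x \<in> {x. 1 < r * g x}" by blast
    qed
    ultimately have "outer K \<le> content {x. 1 < r * g x}"
      unfolding outer_def by (intro INF_lower) auto
    also have "\<dots> \<le> ennreal (r * T g)"
      unfolding content_def
    proof (rule SUP_least, clarify)
      fix f assume f: "f \<in> Cc_nonneg" "\<forall>x. f x \<le> 1" "csupp_in f {x. 1 < r * g x}"
      have "f x \<le> r * g x" for x
        using f(2) csupp_in_zero[OF f(3), of x] Cc_nonnegD(2)[OF g, of x] r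
        by (cases "1 < r * g x") (auto intro: order_trans)
      then have "T f \<le> T (\<lambda>x. r * g x)"
        using f g r by (intro mono Cc_nonneg_scale) auto
      then show "ennreal (T f) \<le> ennreal (r * T g)"
        using g r by (intro ennreal_leI) (simp add: scale)
    qed
    finally show ?thesis unfolding r_def .
  qed
  moreover have "(\<lambda>n. ennreal ((1 + inverse (real (Suc n))) * T g)) \<longlonglongrightarrow> ennreal ((1 + 0) * T g)"
    by (intro tendsto_ennrealI tendsto_mult tendsto_add tendsto_const LIMSEQ_inverse_real_of_nat)
  ultimately show ?thesis
    using LIMSEQ_le_const[of "\<lambda>n. ennreal ((1 + inverse (real (Suc n))) * T g)" "ennreal ((1 + 0) * T g)" "outer K"]
    by simp
qed

lemma outer_ge:
  assumes "g \<in> Cc_nonneg" "\<And>x. g x \<le> 1" "compact K" "\<And>x. x \<notin> K \<Longrightarrow> g x = 0"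
  shows "ennreal (T g) \<le> outer K"
  unfolding outer_def
proof (rule INF_greatest)
  fix U assume "U \<in> {U. open U \<and> K \<subseteq> U}"
  then have "csupp_in g U" unfolding csupp_in_def using assms by blast
  then show "ennreal (T g) \<le> content U" using assms by (intro content_upper)
qed

lemma outer_compact_finite:
  assumes lc: "locally_compact_space (euclidean :: 'a topology)" and "compact K"
  shows "outer K < \<infinity>"
proof -
  obtain u V where "u \<in> Cc_nonneg" "K \<subseteq> V" "\<And>x. x \<in> V \<Longrightarrow> u x = 1"
    using Cc_urysohn[OF lc assms(2) open_UNIV subset_UNIV] by metis
  then have "outer K \<le> ennreal (T u)"
    using assms(2) by (intro outer_compact_le) auto
  then show ?thesis
    using ennreal_less_top[of "T u"] le_less_trans by (metis infinity_ennreal_def)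
qed

end

lemma
  assumes "regular_borel_measure m"
  shows regular_borel_measure_sets: "sets m = sets borel"
    and regular_borel_measure_compact: "compact K \<Longrightarrow> emeasure m K < \<infinity>"
proof -
  note m = assms[unfolded regular_borel_measure_def]
  show "sets m = sets borel"
    by (rule conjunct1[OF m])
  show "emeasure m K < \<infinity>" if "compact K"
    by (rule mp[OF spec[OF conjunct1[OF conjunct2[OF m]]] that])
qed

lemma Cc_nonneg_integrable:
  fixes f :: "'a::t2_space \<Rightarrow> real"
  assumes m: "regular_borel_measure m" and f: "f \<in> Cc_nonneg"
  shows "integrable m f"
proof -
  note sm = regular_borel_measure_sets[OF m]
  obtain K where K: "compact K" "\<And>x. x \<notin> K \<Longrightarrow> f x = 0"
    using Cc_nonnegD(3)[OF f] unfolding csupp_in_def by blast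
  obtain B where B: "0 < B" "\<And>x. f x \<le> B"
    using Cc_nonneg_bounded[OF f] by blast
  have Km: "K \<in> sets m"
    using K(1) sm borel_compact by simp
  have "emeasure m K < \<infinity>"
    using regular_borel_measure_compact[OF m] K(1) .
  then have i1: "integrable m (\<lambda>x. B * indicator K x)"
    using Km by (intro integrable_mult_right integrable_real_indicator)
  have i2: "f \<in> borel_measurable m"
    using borel_measurable_continuous_onI[OF Cc_nonnegD(1)[OF f]]
    by (simp only: measurable_cong_sets[OF sm refl])
  have "norm (f x) \<le> norm (B * indicator K x)" for x
    using B K(2)[of x] Cc_nonnegD(2)[OF f, of x] by (cases "x \<in> K") auto
  then show ?thesis
    using Bochner_Integration.integrable_bound[OF i1 i2] by blast
qed

lemma positive_functional_integral:
  assumes "regular_borel_measure m"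
  shows "positive_functional (\<lambda>f. \<integral>x. f x \<partial>m)"
proof
qed (auto simp: Cc_nonneg_integrable[OF assms] Cc_nonnegD(2))

theorem (in positive_functional) riesz_representation:
  assumes lc: "locally_compact_space (euclidean :: 'a topology)"
  shows "\<exists>m. regular_borel_measure m \<and> (\<forall>f\<in>Cc_nonneg. (\<integral>x. f x \<partial>m) = T f)"
proof -
  define m where "m = measure_of UNIV (sets borel) outer"
  have ms: "measure_space UNIV (sets borel) outer"
    by (rule measure_space_outer[OF lc])
  have sm: "sets m = sets borel"
    using sets.sigma_sets_eq[of "borel :: 'a measure"] by (simp add: m_def)
  have em: "emeasure m A = outer A" if "A \<in> sets borel" for A
    unfolding m_def using ms that by (intro emeasure_measure_of_sigma) (auto simp: measure_space_def)
  have comp: "emeasure m K = outer K" if "compact K" for K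
    using em[OF borel_compact[OF that]] .
  have opn: "emeasure m U = content U" if "open U" for U
    using that em outer_open by simp
  have reg: "regular_borel_measure m"
    unfolding regular_borel_measure_def
  proof (intro conjI allI impI ballI)
    show "emeasure m K < \<infinity>" if "compact K" for K
      using comp outer_compact_finite[OF lc] that by simp
    show "emeasure m A = (INF U\<in>{U. open U \<and> A \<subseteq> U}. emeasure m U)" if "A \<in> sets borel" for A
      unfolding em[OF that] outer_def using opn by (intro INF_cong) auto
    show "emeasure m U = (SUP K\<in>{K. compact K \<and> K \<subseteq> U}. emeasure m K)" if U: "open U" for U
    proof (rule antisym)
      show "emeasure m U \<le> (SUP K\<in>{K. compact K \<and> K \<subseteq> U}. emeasure m K)"
        unfolding opn[OF U] content_def
      proof (rule SUP_mono, clarify)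
        fix f assume f: "f \<in> Cc_nonneg" "\<forall>x. f x \<le> 1" "csupp_in f U"
        obtain K where K: "compact K" "K \<subseteq> U" "\<forall>x. x \<notin> K \<longrightarrow> f x = 0"
          using f(3) unfolding csupp_in_def by blast
        then have "ennreal (T f) \<le> emeasure m K"
          using f comp outer_ge by simp
        then show "\<exists>K\<in>{K. compact K \<and> K \<subseteq> U}. ennreal (T f) \<le> emeasure m K"
          using K by blast
      qed
      show "(SUP K\<in>{K. compact K \<and> K \<subseteq> U}. emeasure m K) \<le> emeasure m U"
        using U sm by (intro SUP_least emeasure_mono) auto
    qed
  qed (rule sm)
  have cm: "outer K = ennreal (measure m K)" if "compact K" for K
    using emeasure_eq_ennreal_measure[of m K] comp[OF that] outer_compact_finite[OF lc that]
    by (simp add: less_top)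
  have Ki: "integrable m (indicator K :: 'a \<Rightarrow> real)" if "compact K" for K
    using sm borel_compact[OF that] regular_borel_measure_compact[OF reg that]
    by (intro integrable_real_indicator) simp_all
  have Ks: "measure m K = (\<integral>x. indicator K x \<partial>m)" for K
    using sm by (simp add: sets_eq_imp_space_eq)
  have "compact_content (\<lambda>f. \<integral>x. f x \<partial>m) (measure m)"
    unfolding compact_content_def Ks
  proof (intro ballI allI impI conjI)
    fix g :: "'a \<Rightarrow> real" and K :: "'a set" assume g: "g \<in> Cc_nonneg" and K: "compact K"
    note gi = Cc_nonneg_integrable[OF reg g] and Ki = Ki[OF K]
    show "(\<integral>x. g x \<partial>m) \<le> (\<integral>x. indicator K x \<partial>m)" if "(\<forall>x. g x \<le> 1) \<and> (\<forall>x. x \<notin> K \<longrightarrow> g x = 0)"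
      using that by (intro integral_mono[OF gi Ki]) (simp add: indicator_def)
    show "(\<integral>x. indicator K x \<partial>m) \<le> (\<integral>x. g x \<partial>m)" if "\<forall>x\<in>K. 1 \<le> g x"
      using that Cc_nonnegD(2)[OF g] by (intro integral_mono[OF Ki gi]) (simp add: indicator_def)
  qed
  moreover have "compact_content T (measure m)"
    unfolding compact_content_def
  proof (intro ballI allI impI conjI)
    fix g :: "'a \<Rightarrow> real" and K :: "'a set" assume g: "g \<in> Cc_nonneg" and K: "compact K"
    show "T g \<le> measure m K" if "(\<forall>x. g x \<le> 1) \<and> (\<forall>x. x \<notin> K \<longrightarrow> g x = 0)"
      using outer_ge[OF g _ K] that cm[OF K] by simp
    show "measure m K \<le> T g" if "\<forall>x\<in>K. 1 \<le> g x"
      using outer_compact_le[OF g K] that cm[OF K] nonneg[OF g] by simp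
  qed
  ultimately have "(\<integral>x. f x \<partial>m) = T f" if "f \<in> Cc_nonneg" for f
    using that by (rule positive_functional_eqI[OF positive_functional_integral[OF reg]
          positive_functional_axioms _ _ measure_nonneg])
  then show ?thesis using reg by blast
qed

section \<open>The Ruelle operator\<close>

locale ruelle_system =
  fixes \<sigma> :: "'a::t2_space \<Rightarrow> 'a" and \<psi> :: "'a \<Rightarrow> real"
  assumes lc: "locally_compact_space (euclidean :: 'a topology)"
    and lh: "local_homeomorphism \<sigma>"
    and cont: "continuous_on UNIV \<psi>"
begin

lemma local_inverse:
  obtains U g where "open U" "x \<in> U" "open (\<sigma> ` U)" "homeomorphism U (\<sigma> ` U) \<sigma> g"
  using lh unfolding local_homeomorphism_def by blast

lemma continuous_sigma: "continuous_on UNIV \<sigma>"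
proof (rule continuous_at_imp_continuous_on, rule ballI)
  fix x
  obtain U g where U: "open U" "x \<in> U" "homeomorphism U (\<sigma> ` U) \<sigma> g"
    using local_inverse[of x] by metis
  then show "isCont \<sigma> x"
    using homeomorphism_cont1[OF U(3)] continuous_on_eq_continuous_at by blast
qed

lemma open_map_sigma:
  assumes V: "open V"
  shows "open (\<sigma> ` V)"
proof (subst open_subopen, rule ballI)
  fix y assume "y \<in> \<sigma> ` V"
  then obtain x where x: "x \<in> V" "y = \<sigma> x" by blast
  obtain U g where U: "open U" "x \<in> U" "open (\<sigma> ` U)" "homeomorphism U (\<sigma> ` U) \<sigma> g"
    using local_inverse[of x] by metis
  have "openin (top_of_set (\<sigma> ` U)) (\<sigma> ` (U \<inter> V))"
    by (rule homeomorphism_imp_open_map[OF U(4)]) (simp add: V openin_open_Int)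
  then have "open (\<sigma> ` (U \<inter> V))"
    using U(3) openin_open_trans by blast
  moreover have "y \<in> \<sigma> ` (U \<inter> V)" "\<sigma> ` (U \<inter> V) \<subseteq> \<sigma> ` V"
    using x U(2) by blast+
  ultimately show "\<exists>T. open T \<and> y \<in> T \<and> T \<subseteq> \<sigma> ` V" by blast
qed

lemma continuous_iterate: "continuous_on UNIV (\<sigma> ^^ n)"
proof (induction n)
  case 0
  show ?case by (simp add: id_def)
next
  case (Suc n)
  then have "continuous_on UNIV (\<sigma> \<circ> (\<sigma> ^^ n))"
    using continuous_sigma by (intro continuous_on_compose) (auto intro: continuous_on_subset)
  then show ?case by simp
qed

lemma open_map_iterate: "open V \<Longrightarrow> open ((\<sigma> ^^ n) ` V)"
proof (induction n)
  case (Suc n)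
  have "(\<sigma> ^^ Suc n) ` V = \<sigma> ` ((\<sigma> ^^ n) ` V)"
    by (simp add: image_comp)
  then show ?case using Suc open_map_sigma by metis
qed simp

lemma finite_fibre:
  assumes K: "compact K"
  shows "finite (\<sigma> -` {x} \<inter> K)"
proof -
  have "closed (\<sigma> -` {x})"
    by (rule closed_vimage[OF closed_singleton continuous_sigma])
  then have c: "compact (\<sigma> -` {x} \<inter> K)"
    using K by (simp add: closed_Int_compact)
  have "\<exists>U. open U \<and> y \<in> U \<and> inj_on \<sigma> U" for y
    using local_inverse[of y] by (metis homeomorphism_apply1 inj_on_inverseI)
  then obtain U where U: "\<And>y. open (U y)" "\<And>y. y \<in> U y" "\<And>y. inj_on \<sigma> (U y)"
    by metis
  have cov: "\<sigma> -` {x} \<inter> K \<subseteq> (\<Union>y\<in>\<sigma> -` {x} \<inter> K. U y)"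
    using U(2) by blast
  obtain D where D: "D \<subseteq> \<sigma> -` {x} \<inter> K" "finite D" "\<sigma> -` {x} \<inter> K \<subseteq> (\<Union>y\<in>D. U y)"
    by (rule compactE_image[OF c U(1) cov])
  have "\<sigma> -` {x} \<inter> K \<subseteq> D"
  proof
    fix z assume z: "z \<in> \<sigma> -` {x} \<inter> K"
    then obtain y where y: "y \<in> D" "z \<in> U y" using D(3) by blast
    then have "\<sigma> z = \<sigma> y" using z D(1) by auto
    then have "z = y" using U(2,3) y(2) by (meson inj_onD)
    then show "z \<in> D" using y by simp
  qed
  then show ?thesis using D(2) finite_subset by blast
qed

abbreviation L :: "('a \<Rightarrow> real) \<Rightarrow> 'a \<Rightarrow> real" where
  "L \<equiv> ruelle \<sigma> \<psi>"

lemma ruelle_finite_sum: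
  assumes "compact K" "\<And>y. y \<notin> K \<Longrightarrow> f y = 0"
  shows "L f x = (\<Sum>y\<in>\<sigma> -` {x} \<inter> K. exp (\<psi> y) * f y)"
proof -
  have "L f x = (\<Sum>\<^sub>\<infinity>y\<in>\<sigma> -` {x} \<inter> K. exp (\<psi> y) * f y)"
    unfolding ruelle_def using assms(2) by (intro infsum_cong_neutral) auto
  then show ?thesis
    using finite_fibre[OF assms(1)] by simp
qed

lemma Cc_nonneg_compact_support:
  assumes "f \<in> Cc_nonneg"
  obtains K where "compact K" "\<And>y. y \<notin> K \<Longrightarrow> f y = 0"
  using Cc_nonnegD(3)[OF assms] unfolding csupp_in_def by blast

lemma ruelle_add:
  assumes "f \<in> Cc_nonneg" "g \<in> Cc_nonneg"
  shows "L (\<lambda>y. f y + g y) x = L f x + L g x"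
proof -
  obtain K K' where K: "compact K" "\<And>y. y \<notin> K \<Longrightarrow> f y = 0" "compact K'" "\<And>y. y \<notin> K' \<Longrightarrow> g y = 0"
    using assms by (metis Cc_nonneg_compact_support)
  have c: "compact (K \<union> K')" using K by auto
  show ?thesis
    using ruelle_finite_sum[OF c, of f x] ruelle_finite_sum[OF c, of g x]
      ruelle_finite_sum[OF c, of "\<lambda>y. f y + g y" x] K(2,4)
    by (simp add: distrib_left sum.distrib)
qed

lemma ruelle_scale: "L (\<lambda>y. c * f y) x = c * L f x"
  unfolding ruelle_def using infsum_cmult_right'[of c "\<lambda>y. exp (\<psi> y) * f y"]
  by (simp add: mult.left_commute)

lemma ruelle_sum:
  assumes "\<And>i. i \<in> I \<Longrightarrow> f i \<in> Cc_nonneg"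
  shows "L (\<lambda>y. \<Sum>i\<in>I. f i y) x = (\<Sum>i\<in>I. L (f i) x)"
  using assms
proof (induction I rule: infinite_finite_induct)
  case (insert i I)
  then show ?case by (simp add: ruelle_add Cc_nonneg_sum)
qed (simp_all add: ruelle_def)

lemma ruelle_pos_iff:
  assumes f: "f \<in> Cc_nonneg"
  shows "0 < L f x \<longleftrightarrow> (\<exists>y. \<sigma> y = x \<and> 0 < f y)"
proof -
  obtain K where K: "compact K" "\<And>y. y \<notin> K \<Longrightarrow> f y = 0"
    using f by (metis Cc_nonneg_compact_support)
  have eq: "L f x = (\<Sum>y\<in>\<sigma> -` {x} \<inter> K. exp (\<psi> y) * f y)"
    by (rule ruelle_finite_sum) (use K in auto)
  have nn: "0 \<le> exp (\<psi> y) * f y" for y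
    using Cc_nonnegD(2)[OF f] by simp
  have "L f x = 0 \<longleftrightarrow> (\<forall>y\<in>\<sigma> -` {x} \<inter> K. exp (\<psi> y) * f y = 0)"
    unfolding eq using finite_fibre[OF K(1)] nn
    by (intro sum_nonneg_eq_0_iff) auto
  moreover have "0 \<le> L f x"
    unfolding eq using nn by (intro sum_nonneg)
  ultimately have "0 < L f x \<longleftrightarrow> (\<exists>y\<in>\<sigma> -` {x} \<inter> K. f y \<noteq> 0)"
    by (auto simp: less_le)
  moreover have "f y \<noteq> 0 \<longleftrightarrow> 0 < f y" for y
    using Cc_nonnegD(2)[OF f, of y] by linarith
  ultimately show ?thesis
    using K(2) by force
qed

lemma ruelle_local:
  assumes hom: "homeomorphism U (\<sigma> ` U) \<sigma> g" and f: "csupp_in f U"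
  shows "L f x = (if x \<in> \<sigma> ` U then exp (\<psi> (g x)) * f (g x) else 0)"
proof -
  have z: "f y = 0" if "y \<notin> U" for y
    using csupp_in_zero[OF f that] .
  show ?thesis
  proof (cases "x \<in> \<sigma> ` U")
    case True
    have g: "g x \<in> U" "\<sigma> (g x) = x"
      using True hom homeomorphism_image2[OF hom] homeomorphism_apply2[OF hom] by auto
    have "L f x = (\<Sum>\<^sub>\<infinity>y\<in>{g x}. exp (\<psi> y) * f y)"
      unfolding ruelle_def
    proof (rule infsum_cong_neutral)
      fix y assume "y \<in> \<sigma> -` {x} - {g x}"
      then have "y \<notin> U" using homeomorphism_apply1[OF hom, of y] by auto
      then show "exp (\<psi> y) * f y = 0" using z by simp
    qed (use g in auto)
    then show ?thesis using True by simp
  next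
    case False
    have "exp (\<psi> y) * f y = 0" if "y \<in> \<sigma> -` {x}" for y
      using that False z[of y] by auto
    then have "L f x = 0" unfolding ruelle_def by (rule infsum_0)
    then show ?thesis using False by simp
  qed
qed

lemma ruelle_Cc_nonneg:
  assumes f: "f \<in> Cc_nonneg"
  shows "L f \<in> Cc_nonneg"
proof -
  have "\<exists>U g. open U \<and> x \<in> U \<and> open (\<sigma> ` U) \<and> homeomorphism U (\<sigma> ` U) \<sigma> g" for x
    using local_inverse[of x] by metis
  then obtain U g where U: "\<And>x. open (U x)" "\<And>x. x \<in> U x" "\<And>x. open (\<sigma> ` U x)"
    "\<And>x. homeomorphism (U x) (\<sigma> ` U x) \<sigma> (g x)"
    by metis
  have cov: "csupp_in f (\<Union>x. U x)"
    using Cc_nonnegD(3)[OF f] U(2) by (elim csupp_in_mono) blast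
  obtain J F where JF: "finite J" "J \<subseteq> UNIV" "\<And>i. i \<in> J \<Longrightarrow> F i \<in> Cc_nonneg"
    "\<And>i. i \<in> J \<Longrightarrow> csupp_in (F i) (U i)" "\<And>x. f x = (\<Sum>i\<in>J. F i x)"
    by (rule Cc_nonneg_split_cover[OF lc f cov U(1)]) (rule that; simp)
  have "L (F i) \<in> Cc_nonneg" if i: "i \<in> J" for i
  proof -
    let ?f = "\<lambda>y. F i y * exp (\<psi> y)"
    have "L (F i) = (\<lambda>x. if x \<in> \<sigma> ` U i then ?f (g i x) else 0)"
      using ruelle_local[OF U(4) JF(4)[OF i]] by (auto simp: mult.commute)
    moreover have "?f \<in> Cc_nonneg"
      using JF(3)[OF i] cont by (intro Cc_nonneg_mult continuous_intros) auto
    moreover have "csupp_in ?f (U i)"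
      by (rule csupp_in_dominated[OF JF(4)[OF i]]) simp
    ultimately show ?thesis
      using Cc_nonneg_transport[OF U(3,4)] by simp
  qed
  then have "(\<lambda>x. \<Sum>i\<in>J. L (F i) x) \<in> Cc_nonneg"
    by (rule Cc_nonneg_sum)
  moreover have "f = (\<lambda>x. \<Sum>i\<in>J. F i x)" using JF(5) by blast
  then have "L f = (\<lambda>x. \<Sum>i\<in>J. L (F i) x)"
    using ruelle_sum[of J F] JF(3) by auto
  ultimately show ?thesis by simp
qed

lemma ruelle_mono:
  assumes "f \<in> Cc_nonneg" "g \<in> Cc_nonneg" "\<And>y. f y \<le> g y"
  shows "L f x \<le> L g x"
proof -
  have d: "(\<lambda>y. g y - f y) \<in> Cc_nonneg"
    using assms by (intro Cc_nonneg_diff)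
  have "L g x = L (\<lambda>y. f y + (g y - f y)) x"
    by simp
  also have "\<dots> = L f x + L (\<lambda>y. g y - f y) x"
    by (rule ruelle_add[OF assms(1) d])
  finally show ?thesis
    using Cc_nonnegD(2)[OF ruelle_Cc_nonneg[OF d], of x] by simp
qed

lemma iterate_Cc_nonneg: "f \<in> Cc_nonneg \<Longrightarrow> (L ^^ n) f \<in> Cc_nonneg"
  by (induction n) (auto intro: ruelle_Cc_nonneg)

lemma iterate_nonneg: "f \<in> Cc_nonneg \<Longrightarrow> 0 \<le> (L ^^ n) f x"
  by (rule Cc_nonnegD(2)[OF iterate_Cc_nonneg])

lemma iterate_add:
  assumes "f \<in> Cc_nonneg" "g \<in> Cc_nonneg"
  shows "(L ^^ n) (\<lambda>y. f y + g y) = (\<lambda>x. (L ^^ n) f x + (L ^^ n) g x)"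
  using assms by (induction n) (auto simp: ruelle_add iterate_Cc_nonneg)

lemma iterate_scale: "(L ^^ n) (\<lambda>y. c * f y) = (\<lambda>x. c * (L ^^ n) f x)"
  by (induction n) (auto simp: ruelle_scale)

lemma iterate_sum:
  assumes "\<And>i. i \<in> I \<Longrightarrow> f i \<in> Cc_nonneg"
  shows "(L ^^ n) (\<lambda>y. \<Sum>i\<in>I. f i y) = (\<lambda>x. \<Sum>i\<in>I. (L ^^ n) (f i) x)"
  using assms by (induction n) (auto simp: ruelle_sum iterate_Cc_nonneg)

lemma iterate_mono:
  assumes "f \<in> Cc_nonneg" "g \<in> Cc_nonneg" "\<And>y. f y \<le> g y"
  shows "(L ^^ n) f x \<le> (L ^^ n) g x"
  using assms(3)
  by (induction n arbitrary: x) (auto intro!: ruelle_mono iterate_Cc_nonneg assms)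

lemma iterate_pos_iff:
  assumes f: "f \<in> Cc_nonneg"
  shows "0 < (L ^^ n) f x \<longleftrightarrow> (\<exists>y. (\<sigma> ^^ n) y = x \<and> 0 < f y)"
proof (induction n arbitrary: x)
  case (Suc n)
  show ?case
    using ruelle_pos_iff[OF iterate_Cc_nonneg[OF f]] Suc by auto
qed simp

text \<open>By cofinality the sum on the right is positive on the compact set that carries the
  function on the left.\<close>

lemma iterate_comparison:
  assumes cof: "cofinal_system \<sigma>"
    and f: "f \<in> Cc_nonneg" and h: "h \<in> Cc_nonneg" "0 < h z"
  obtains N M C where "0 \<le> C" "\<And>x. (L ^^ N) f x \<le> C * (\<Sum>l\<le>M. (L ^^ l) h x)"
proof -
  let ?U = "{x. 0 < h x}"
  obtain K where K: "compact K" "\<And>y. y \<notin> K \<Longrightarrow> f y = 0"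
    using f by (metis Cc_nonneg_compact_support)
  have U: "open ?U" "?U \<noteq> {}"
    using h Cc_nonnegD(1)[OF h(1)] by (auto intro: open_Collect_less)
  let ?W = "\<lambda>(i, j). (\<sigma> ^^ i) -` ((\<sigma> ^^ j) ` ?U)"
  have Wo: "open (?W p)" for p
    using open_vimage[OF open_map_iterate[OF U(1)] continuous_iterate] by (simp add: split_beta)
  have "(\<Union>i. \<Union>j. (\<sigma> ^^ i) -` ((\<sigma> ^^ j) ` ?U)) = UNIV"
    using cof U unfolding cofinal_system_def by simp
  then have cov: "K \<subseteq> (\<Union>p\<in>UNIV. ?W p)"
    by fastforce
  obtain D where D: "finite D" "K \<subseteq> (\<Union>p\<in>D. ?W p)"
    by (rule compactE_image[OF K(1) Wo cov])
  define N where "N = Max (insert 0 (fst ` D))"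
  define M where "M = N + Max (insert 0 (snd ` D))"
  define S where "S x = (\<Sum>l\<le>M. (L ^^ l) h x)" for x
  have S: "S \<in> Cc_nonneg"
    unfolding S_def using h(1) by (intro Cc_nonneg_sum iterate_Cc_nonneg)
  have Spos: "0 < S ((\<sigma> ^^ N) y)" if y: "y \<in> K" for y
  proof -
    obtain i j where ij: "(i, j) \<in> D" "(\<sigma> ^^ i) y \<in> (\<sigma> ^^ j) ` ?U"
      using D(2) y by fastforce
    then obtain u where u: "0 < h u" "(\<sigma> ^^ i) y = (\<sigma> ^^ j) u" by blast
    have iN: "i \<le> N" unfolding N_def using ij(1) D(1) by (intro Max_ge) force+
    have "j \<le> Max (insert 0 (snd ` D))" using ij(1) D(1) by (intro Max_ge) force+
    then have jM: "N - i + j \<le> M" unfolding M_def by simp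
    have "(\<sigma> ^^ (N - i + j)) u = (\<sigma> ^^ (N - i)) ((\<sigma> ^^ i) y)"
      using u(2) by (simp add: funpow_add)
    also have "\<dots> = (\<sigma> ^^ N) y"
      using iN by (metis comp_apply funpow_add le_add_diff_inverse2)
    finally have "0 < (L ^^ (N - i + j)) h ((\<sigma> ^^ N) y)"
      using iterate_pos_iff[OF h(1)] u(1) by blast
    also have "\<dots> \<le> S ((\<sigma> ^^ N) y)"
      unfolding S_def using jM iterate_nonneg[OF h(1)] by (intro member_le_sum) auto
    finally show ?thesis .
  qed
  obtain B where B: "0 < B" "\<And>x. (L ^^ N) f x \<le> B"
    using Cc_nonneg_bounded[OF iterate_Cc_nonneg[OF f]] by metis
  obtain c where c: "0 < c" "\<And>y. y \<in> K \<Longrightarrow> c \<le> S ((\<sigma> ^^ N) y)"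
  proof (cases "K = {}")
    case True
    then show ?thesis using that[of 1] by simp
  next
    case False
    have "continuous_on K (\<lambda>y. S ((\<sigma> ^^ N) y))"
      using Cc_nonnegD(1)[OF S] continuous_iterate
      by (intro continuous_on_compose2[of UNIV S K]) (auto intro: continuous_on_subset)
    then obtain y0 where "y0 \<in> K" "\<And>y. y \<in> K \<Longrightarrow> S ((\<sigma> ^^ N) y0) \<le> S ((\<sigma> ^^ N) y)"
      using continuous_attains_inf[OF K(1) False] by metis
    then show ?thesis using that Spos by blast
  qed
  have "(L ^^ N) f x \<le> B / c * S x" for x
  proof (cases "0 < (L ^^ N) f x")
    case True
    then obtain y where y: "(\<sigma> ^^ N) y = x" "0 < f y"
      using iterate_pos_iff[OF f] by blast
    then have "y \<in> K" using K(2)[of y] by force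
    then have "c \<le> S x" using c(2) y(1) by blast
    then have "B \<le> B / c * S x"
      using B(1) c(1) by (simp add: field_simps)
    then show ?thesis using B(2) by (rule order_trans[rotated])
  next
    case False
    moreover have "0 \<le> B / c * S x"
      using B(1) c(1) Cc_nonnegD(2)[OF S] by simp
    ultimately show ?thesis by simp
  qed
  then show thesis
    using that[of "B / c" N M] B(1) c(1) unfolding S_def by simp
qed

end

section \<open>Conformality and invariant functionals\<close>

lemma open_approx_Cc_nonneg:
  fixes W :: "'a::{t2_space, second_countable_topology} set"
  assumes lc: "locally_compact_space (euclidean :: 'a topology)" and W: "open W"
  obtains f :: "nat \<Rightarrow> 'a \<Rightarrow> real"
  where "\<And>n. f n \<in> Cc_nonneg" "\<And>n. csupp_in (f n) W" "\<And>x. incseq (\<lambda>n. f n x)"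
    "\<And>x. (\<lambda>n. f n x) \<longlonglongrightarrow> indicator W x"
proof -
  have "\<exists>u V. open V \<and> x \<in> V \<and> u \<in> Cc_nonneg \<and> csupp_in u W \<and> (x \<in> W \<longrightarrow> (\<forall>y\<in>V. u y = 1))" for x :: 'a
  proof (cases "x \<in> W")
    case True
    then have "compact {x}" "{x} \<subseteq> W" by auto
    then obtain u V where "u \<in> Cc_nonneg" "csupp_in u W" "open V" "{x} \<subseteq> V" "\<And>y. y \<in> V \<Longrightarrow> u y = (1::real)"
      using Cc_urysohn[OF lc _ W] by metis
    then show ?thesis by blast
  next
    case False
    have "csupp_in (\<lambda>x. 0) W"
      unfolding csupp_in_def by (auto intro: exI[of _ "{}"])
    then show ?thesis
      using False Cc_nonneg_zero open_UNIV by blast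
  qed
  then obtain u V where uV: "\<And>x. open (V x)" "\<And>x. x \<in> V x" "\<And>x. u x \<in> Cc_nonneg" "\<And>x. csupp_in (u x) W"
    "\<And>x y. x \<in> W \<Longrightarrow> y \<in> V x \<Longrightarrow> u x y = (1::real)"
    by metis
  have cs0: "csupp_in (\<lambda>x. 0) W"
    unfolding csupp_in_def by (auto intro: exI[of _ "{}"])
  obtain F where F: "F \<subseteq> V ` W" "countable F" "\<Union>F = \<Union>(V ` W)"
    using Lindelof[of "V ` W"] uV(1) by blast
  show thesis
  proof (cases "W = {}")
    case True
    then show thesis
      using that[of "\<lambda>n x. 0"] Cc_nonneg_zero cs0 by simp
  next
    case False
    then have "F \<noteq> {}" using F(3) uV(2) by blast
    then have rF: "range (from_nat_into F) = F"
      using F(2) by (rule range_from_nat_into)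
    then have "\<exists>x\<in>W. from_nat_into F n = V x" for n
      using F(1) by (metis imageE rangeI subsetD)
    then obtain e where e: "\<And>n. e n \<in> W" "\<And>n. from_nat_into F n = V (e n)" by metis
    let ?s = "\<lambda>n x. \<Sum>i<n. u (e i) x"
    let ?f = "\<lambda>n x. min 1 (?s n x)"
    have nn: "0 \<le> u (e i) x" for i x
      using Cc_nonnegD(2)[OF uV(3)] .
    have s: "?s n \<in> Cc_nonneg" for n
      using uV(3) by (intro Cc_nonneg_sum)
    have ss: "csupp_in (?s n) W" for n
      by (induction n) (use cs0 in \<open>auto intro: csupp_in_add uV(4)\<close>)
    show thesis
    proof (rule that[of ?f])
      fix n x
      show "?f n \<in> Cc_nonneg"
        by (rule Cc_nonneg_dominated[OF s[of n]])
          (use s[of n] nn in \<open>auto intro!: continuous_intros sum_nonneg simp: Cc_nonneg_def\<close>)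
      show "csupp_in (?f n) W"
        by (rule csupp_in_dominated[OF ss[of n]]) simp
      show "incseq (\<lambda>n. ?f n x)"
        by (intro incseq_SucI min.mono) (use nn in simp_all)
      show "(\<lambda>n. ?f n x) \<longlonglongrightarrow> indicator W x"
      proof (cases "x \<in> W")
        case True
        then have "x \<in> \<Union>(range (from_nat_into F))"
          unfolding rF F(3) using uV(2) by blast
        then obtain i where i: "x \<in> V (e i)" using e(2) by auto
        have "?f n x = 1" if "i < n" for n
        proof -
          have "u (e i) x \<le> ?s n x"
            using that nn by (intro member_le_sum) auto
          then show ?thesis using uV(5)[OF e(1) i] by simp
        qed
        then have "eventually (\<lambda>n. ?f n x = indicator W x) sequentially"
          using True by (intro eventually_sequentiallyI[of "Suc i"]) auto
        then show ?thesis by (rule tendsto_eventually)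
      next
        case False
        then have "?f n x = 0" for n
          using csupp_in_zero[OF ss False] by simp
        then show ?thesis using False by simp
      qed
    qed
  qed
qed

lemma (in ruelle_system) lift_local:
  assumes U: "open U" and hom: "homeomorphism U (\<sigma> ` U) \<sigma> g"
    and f: "f \<in> Cc_nonneg" "csupp_in f (\<sigma> ` U)"
  defines "f' \<equiv> \<lambda>y. (if y \<in> U then f (\<sigma> y) else 0) * exp (- \<psi> y)"
  shows "f' \<in> Cc_nonneg" "L f' = f"
proof -
  have hom': "homeomorphism (\<sigma> ` U) U g \<sigma>"
    using hom by (simp add: homeomorphism_symD)
  have t: "(\<lambda>y. if y \<in> U then f (\<sigma> y) else 0) \<in> Cc_nonneg"
    by (rule Cc_nonneg_transport[OF U hom' f])
  show "f' \<in> Cc_nonneg"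
    unfolding f'_def using cont by (intro Cc_nonneg_mult[OF t] continuous_intros) auto
  show "L f' = f"
  proof
    fix x
    obtain K where K: "compact K" "K \<subseteq> \<sigma> ` U" "\<forall>x. x \<notin> K \<longrightarrow> f x = 0"
      using f(2) unfolding csupp_in_def by blast
    have gK: "compact (g ` K)"
      using compact_continuous_image[OF continuous_on_subset[OF homeomorphism_cont2[OF hom] K(2)] K(1)] .
    have "g ` K \<subseteq> U"
      using K(2) homeomorphism_image2[OF hom] by blast
    moreover have "f' y = 0" if "y \<notin> g ` K" for y
    proof (cases "y \<in> U")
      case True
      then have "g (\<sigma> y) = y" using homeomorphism_apply1[OF hom] by simp
      then have "\<sigma> y \<notin> K" using that by (metis image_eqI)
      then show ?thesis using K(3) by (simp add: f'_def)
    qed (simp add: f'_def)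
    ultimately have cs: "csupp_in f' U"
      unfolding csupp_in_def using gK by blast
    show "L f' x = f x"
    proof (cases "x \<in> \<sigma> ` U")
      case True
      then have "g x \<in> U" "\<sigma> (g x) = x"
        using homeomorphism_image2[OF hom] homeomorphism_apply2[OF hom] by auto
      then show ?thesis
        unfolding ruelle_local[OF hom cs] using True by (simp add: f'_def exp_minus)
    next
      case False
      then show ?thesis
        unfolding ruelle_local[OF hom cs] using csupp_in_zero[OF f(2) False] by simp
    qed
  qed
qed

context
  fixes \<sigma> :: "'a::{t2_space, second_countable_topology} \<Rightarrow> 'a" and \<phi> :: "'a \<Rightarrow> real"
    and m :: "'a measure"
  assumes sys: "ruelle_system \<sigma> (\<lambda>x. - \<phi> x)" and reg: "regular_borel_measure m"
    and inv: "\<And>f. f \<in> Cc_nonneg \<Longrightarrow> (\<integral>x. ruelle \<sigma> (\<lambda>x. - \<phi> x) f x \<partial>m) = (\<integral>x. f x \<partial>m)"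
begin

interpretation ruelle_system \<sigma> "\<lambda>x. - \<phi> x" by (rule sys)

definition weighted :: "'a measure" where
  "weighted = density m (\<lambda>x. ennreal (exp (\<phi> x)))"

lemma sets_m: "sets m = sets borel"
  by (rule regular_borel_measure_sets[OF reg])

lemma measurable_m: "continuous_on UNIV (f :: 'a \<Rightarrow> real) \<Longrightarrow> f \<in> borel_measurable m"
  using borel_measurable_continuous_onI[of f] by (simp only: measurable_cong_sets[OF sets_m refl])

lemma cont_phi: "continuous_on UNIV \<phi>"
  using continuous_on_minus[OF cont] by simp

lemma sets_weighted: "sets weighted = sets borel"
  by (simp add: weighted_def sets_m)

lemma emeasure_weighted:
  assumes "A \<in> sets borel"
  shows "emeasure weighted A = (\<integral>\<^sup>+x\<in>A. ennreal (exp (\<phi> x)) \<partial>m)"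
  unfolding weighted_def
  using assms measurable_m[of "\<lambda>x. exp (\<phi> x)"] cont_phi
  by (intro emeasure_density) (auto intro!: continuous_intros simp: sets_m)

lemma borel_sigma: "\<sigma> \<in> borel_measurable borel"
  by (rule borel_measurable_continuous_onI[OF continuous_sigma])

lemma emeasure_open_image:
  assumes U: "open U" "open (\<sigma> ` U)" and hom: "homeomorphism U (\<sigma> ` U) \<sigma> g"
    and W: "open W" "W \<subseteq> \<sigma> ` U"
  shows "emeasure m W = emeasure weighted (U \<inter> \<sigma> -` W)"
proof -
  obtain f :: "nat \<Rightarrow> 'a \<Rightarrow> real"
  where f: "\<And>n. f n \<in> Cc_nonneg" "\<And>n. csupp_in (f n) W" "\<And>x. incseq (\<lambda>n. f n x)"
    "\<And>x. (\<lambda>n. f n x) \<longlonglongrightarrow> indicator W x"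
    using open_approx_Cc_nonneg[OF lc W(1)] by metis
  define f' where "f' n y = (if y \<in> U then f n (\<sigma> y) else 0) * exp (\<phi> y)" for n y
  have f': "f' n \<in> Cc_nonneg" "L (f' n) = f n" for n
    using lift_local[OF U(1) hom f(1) csupp_in_mono[OF f(2) W(2)], of n]
    unfolding f'_def by simp_all
  have nn_eq: "(\<integral>\<^sup>+x. ennreal (F x) \<partial>m) = ennreal (\<integral>x. F x \<partial>m)" if "F \<in> Cc_nonneg" for F
    by (rule nn_integral_eq_integral[OF Cc_nonneg_integrable[OF reg that]])
      (simp add: Cc_nonnegD(2)[OF that])
  have eq: "(\<integral>\<^sup>+x. ennreal (f n x) \<partial>m) = (\<integral>\<^sup>+x. ennreal (f' n x) \<partial>m)" for n
    unfolding nn_eq[OF f(1)] nn_eq[OF f'(1)] using inv[OF f'(1), of n] f'(2)[of n] by simp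
  have lim: "(\<lambda>n. \<integral>\<^sup>+x. ennreal (F n x) \<partial>m) \<longlonglongrightarrow> (\<integral>\<^sup>+x. ennreal (F' x) \<partial>m)"
    if F: "\<And>n. F n \<in> Cc_nonneg" "\<And>x. incseq (\<lambda>n. F n x)" "\<And>x. (\<lambda>n. F n x) \<longlonglongrightarrow> F' x" for F F'
  proof (rule nn_integral_LIMSEQ)
    show "incseq (\<lambda>n x. ennreal (F n x))"
      using F(2) by (auto simp: incseq_def le_fun_def intro!: ennreal_leI)
    show "(\<lambda>x. ennreal (F n x)) \<in> borel_measurable m" for n
      using measurable_m[OF Cc_nonnegD(1)[OF F(1)]] by simp
    show "(\<lambda>n. ennreal (F n x)) \<longlonglongrightarrow> ennreal (F' x)" for x
      using F(3) by (intro tendsto_ennrealI)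
  qed
  let ?F' = "\<lambda>y. (if y \<in> U then indicator W (\<sigma> y) else 0) * exp (\<phi> y)"
  have "(\<lambda>n. \<integral>\<^sup>+x. ennreal (f n x) \<partial>m) \<longlonglongrightarrow> (\<integral>\<^sup>+x. ennreal (indicator W x) \<partial>m)"
    by (rule lim[OF f(1,3,4)])
  moreover have "(\<lambda>n. \<integral>\<^sup>+x. ennreal (f' n x) \<partial>m) \<longlonglongrightarrow> (\<integral>\<^sup>+x. ennreal (?F' x) \<partial>m)"
  proof (rule lim[OF f'(1)])
    show "incseq (\<lambda>n. f' n x)" for x
      using f(3) by (auto simp: f'_def incseq_def)
    show "(\<lambda>n. f' n x) \<longlonglongrightarrow> ?F' x" for x
      unfolding f'_def using f(4) by (intro tendsto_mult tendsto_const) auto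
  qed
  ultimately have "(\<integral>\<^sup>+x. ennreal (indicator W x) \<partial>m) = (\<integral>\<^sup>+x. ennreal (?F' x) \<partial>m)"
    unfolding eq by (rule LIMSEQ_unique)
  moreover have "(\<integral>\<^sup>+x. ennreal (indicator W x) \<partial>m) = emeasure m W"
    using W(1) by (simp add: sets_m ennreal_indicator)
  moreover have "(\<integral>\<^sup>+x. ennreal (?F' x) \<partial>m) = emeasure weighted (U \<inter> \<sigma> -` W)"
  proof (subst emeasure_weighted)
    show "U \<inter> \<sigma> -` W \<in> sets borel"
      using U(1) open_vimage[OF W(1) continuous_sigma] by auto
    show "(\<integral>\<^sup>+x. ennreal (?F' x) \<partial>m) = (\<integral>\<^sup>+x\<in>U \<inter> \<sigma> -` W. ennreal (exp (\<phi> x)) \<partial>m)"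
      by (rule nn_integral_cong) (simp add: indicator_def)
  qed
  ultimately show ?thesis by simp
qed

lemma emeasure_borel_image:
  assumes U: "open U" "open (\<sigma> ` U)" and hom: "homeomorphism U (\<sigma> ` U) \<sigma> g"
    and A: "A \<in> sets borel" "A \<subseteq> U"
  shows "\<sigma> ` A \<in> sets borel" "emeasure m (\<sigma> ` A) = emeasure weighted A"
proof -
  let ?V = "\<sigma> ` U"
  define M1 where "M1 = density m (indicator ?V)"
  define M2 where "M2 = distr (density weighted (indicator U)) borel \<sigma>"
  have Um: "U \<in> sets weighted" using U(1) by (simp add: sets_weighted)
  have sm: "\<sigma> \<in> measurable (density weighted (indicator U)) borel"
    using borel_sigma by (simp add: measurable_cong_sets[OF sets_weighted refl])
  have M1: "emeasure M1 B = emeasure m (?V \<inter> B)" if "B \<in> sets borel" for B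
    unfolding M1_def using that U(2) by (intro emeasure_restricted) (auto simp: sets_m)
  have M2: "emeasure M2 B = emeasure weighted (U \<inter> \<sigma> -` B)" if B: "B \<in> sets borel" for B
  proof -
    have sp: "space (density weighted (indicator U)) = UNIV"
      using sets_eq_imp_space_eq[OF sets_weighted] by simp
    have "\<sigma> -` B \<in> sets weighted"
      using measurable_sets[OF borel_sigma B] by (simp add: sets_weighted)
    then have "emeasure (density weighted (indicator U)) (\<sigma> -` B) = emeasure weighted (U \<inter> \<sigma> -` B)"
      by (intro emeasure_restricted Um)
    then show ?thesis
      unfolding M2_def using emeasure_distr[OF sm B] sp by simp
  qed
  obtain N K :: "nat \<Rightarrow> 'a set" where N: "\<And>n. open (N n)" "\<And>n. compact (K n)" "\<And>n. N n \<subseteq> K n"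
    and cover: "(\<Union>n. N n) = UNIV"
    by (rule countable_precompact_cover[OF lc]) (rule that; (assumption | blast))
  have sb: "sets borel = sigma_sets UNIV (Collect open :: 'a set set)"
    by (simp add: borel_def)
  have "M1 = M2"
  proof (rule measure_eqI_generator_eq[of "Collect open" UNIV M1 M2 N])
    show "Int_stable (Collect open :: 'a set set)"
      by (auto simp: Int_stable_def)
    fix B :: "'a set" assume "B \<in> Collect open"
    then have B: "open B" by simp
    have "emeasure m (?V \<inter> B) = emeasure weighted (U \<inter> \<sigma> -` (?V \<inter> B))"
      using U(2) B by (intro emeasure_open_image[OF U hom]) auto
    moreover have "U \<inter> \<sigma> -` (?V \<inter> B) = U \<inter> \<sigma> -` B" by blast
    ultimately show "emeasure M1 B = emeasure M2 B"
      using M1[of B] M2[of B] B by simp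
  next
    show "sets M1 = sigma_sets UNIV (Collect open)" "sets M2 = sigma_sets UNIV (Collect open)"
      unfolding sb[symmetric] M1_def M2_def by (simp_all add: sets_m)
    show "range N \<subseteq> Collect open" using N(1) by blast
    fix n
    have "emeasure M1 (N n) = emeasure m (?V \<inter> N n)"
      using M1 N(1) by simp
    also have "\<dots> \<le> emeasure m (K n)"
    proof (rule emeasure_mono)
      show "?V \<inter> N n \<subseteq> K n" using N(3) by blast
      show "K n \<in> sets m" using borel_compact[OF N(2)] by (simp add: sets_m)
    qed
    also have "\<dots> < \<infinity>"
      using regular_borel_measure_compact[OF reg N(2)] .
    finally show "emeasure M1 (N n) \<noteq> \<infinity>" by simp
  qed (use cover in auto)
  have "g \<in> borel_measurable (restrict_space borel ?V)"
    using homeomorphism_cont2[OF hom] by (intro borel_measurable_continuous_on_restrict)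
  then have "g -` A \<inter> space (restrict_space borel ?V) \<in> sets (restrict_space borel ?V)"
    using A(1) by (rule measurable_sets)
  then have "g -` A \<inter> ?V \<in> sets borel"
    using U(2) by (simp add: space_restrict_space sets_restrict_space_iff)
  moreover have "g -` A \<inter> ?V = \<sigma> ` A"
  proof (intro equalityI subsetI)
    fix y assume "y \<in> g -` A \<inter> ?V"
    then show "y \<in> \<sigma> ` A"
      using homeomorphism_apply2[OF hom, of y] by (metis IntD1 IntD2 image_eqI vimageD)
  next
    fix y assume "y \<in> \<sigma> ` A"
    then obtain x where "x \<in> A" "y = \<sigma> x" by blast
    then show "y \<in> g -` A \<inter> ?V"
      using homeomorphism_apply1[OF hom, of x] A(2) by auto
  qed
  ultimately show sA: "\<sigma> ` A \<in> sets borel" by simp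
  have "inj_on \<sigma> U"
    using homeomorphism_apply1[OF hom] by (rule inj_on_inverseI)
  then have "U \<inter> \<sigma> -` (\<sigma> ` A) = A"
    using A(2) inj_on_image_mem_iff[of \<sigma> U _ A] by blast
  moreover have "?V \<inter> \<sigma> ` A = \<sigma> ` A" using A(2) by blast
  ultimately show "emeasure m (\<sigma> ` A) = emeasure weighted A"
    using M1[OF sA] M2[OF sA] \<open>M1 = M2\<close> by simp
qed

lemma conformal_if_invariant:
  assumes nz: "emeasure m UNIV \<noteq> 0"
  shows "conformal_measure \<sigma> \<phi> m"
proof -
  have "emeasure m (\<sigma> ` A) = emeasure weighted A" if A: "A \<in> sets borel" "inj_on \<sigma> A" for A
  proof -
    have "\<exists>U g. open U \<and> x \<in> U \<and> open (\<sigma> ` U) \<and> homeomorphism U (\<sigma> ` U) \<sigma> g" for x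
      using local_inverse[of x] by metis
    then obtain U g where U: "\<And>x. open (U x)" "\<And>x. x \<in> U x" "\<And>x. open (\<sigma> ` U x)"
      "\<And>x. homeomorphism (U x) (\<sigma> ` U x) \<sigma> (g x)"
      by metis
    obtain e :: "nat \<Rightarrow> 'a" where e: "(\<Union>n. U (e n)) = UNIV"
      by (rule countable_subcover_nat[OF U(1,2)])
    define D where "D n = A \<inter> disjointed (\<lambda>n. U (e n)) n" for n
    have "range (disjointed (\<lambda>n. U (e n))) \<subseteq> sets borel"
      by (rule sets.range_disjointed_sets) (use U(1) in auto)
    then have Db: "D n \<in> sets borel" for n
      unfolding D_def using A(1) by blast
    have DU: "D n \<subseteq> U (e n)" for n
      unfolding D_def using disjointed_subset[of "\<lambda>n. U (e n)" n] by blast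
    have dD: "disjoint_family D"
      using disjoint_family_disjointed[of "\<lambda>n. U (e n)"]
      unfolding D_def disjoint_family_on_def by blast
    have UD: "(\<Union>n. D n) = A"
      unfolding D_def using UN_disjointed_eq[of "\<lambda>n. U (e n)"] e by auto
    have "disjoint_family (\<lambda>n. \<sigma> ` D n)"
      unfolding disjoint_family_on_def
    proof (intro ballI impI)
      fix i j :: nat assume "i \<noteq> j"
      then have "D i \<inter> D j = {}" using dD by (simp add: disjoint_family_on_def)
      moreover have "D i \<subseteq> A" "D j \<subseteq> A" by (auto simp: D_def)
      ultimately show "\<sigma> ` D i \<inter> \<sigma> ` D j = {}"
        using inj_on_image_Int[OF A(2), of "D i" "D j"] by simp
    qed
    then have "(\<Sum>n. emeasure m (\<sigma> ` D n)) = emeasure m (\<Union>n. \<sigma> ` D n)"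
      using emeasure_borel_image(1)[OF U(1,3,4) Db DU]
      by (intro suminf_emeasure) (auto simp: sets_m)
    moreover have "(\<Sum>n. emeasure weighted (D n)) = emeasure weighted (\<Union>n. D n)"
      using Db dD by (intro suminf_emeasure) (auto simp: sets_weighted)
    moreover have "(\<Union>n. \<sigma> ` D n) = \<sigma> ` A" using UD by blast
    ultimately show ?thesis
      using emeasure_borel_image(2)[OF U(1,3,4) Db DU] UD by simp
  qed
  then show ?thesis
    unfolding conformal_measure_def using reg nz emeasure_weighted by simp
qed

end

section \<open>Construction of an invariant functional\<close>

lemma compact_function_box:
  fixes B :: "'b \<Rightarrow> real"
  shows "compact {F. \<forall>b. \<bar>F b\<bar> \<le> B b}"
proof -
  have "compactin (product_topology (\<lambda>_. euclidean) UNIV) (PiE UNIV (\<lambda>b. {- B b..B b}))"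
    unfolding compactin_PiE by simp
  moreover have "PiE UNIV (\<lambda>b. {- B b..B b}) = {F. \<forall>b. \<bar>F b\<bar> \<le> B b}"
    by (auto simp: PiE_iff abs_le_iff minus_le_iff)
  ultimately show ?thesis
    by (simp add: euclidean_product_topology)
qed

lemma bounded_pointwise_cluster_filter:
  fixes F :: "nat \<Rightarrow> 'b \<Rightarrow> real"
  assumes "\<And>b. \<exists>B. \<forall>k. \<bar>F k b\<bar> \<le> B"
  obtains G l where "G \<noteq> bot" "G \<le> sequentially" "\<And>b. ((\<lambda>k. F k b) \<longlongrightarrow> l b) G"
proof -
  obtain B where B: "\<And>k b. \<bar>F k b\<bar> \<le> B b"
    using assms by metis
  have "eventually (\<lambda>f. f \<in> {f. \<forall>b. \<bar>f b\<bar> \<le> B b}) (filtermap F sequentially)"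
    using B by (simp add: eventually_filtermap)
  moreover have "filtermap F sequentially \<noteq> bot"
    by (simp add: filtermap_bot_iff)
  ultimately obtain l where l: "inf (nhds l) (filtermap F sequentially) \<noteq> bot"
    using compact_function_box[of B] unfolding compact_filter by blast
  define G where "G = inf (filtercomap F (nhds l)) sequentially"
  have "G \<noteq> bot"
  proof
    assume "G = bot"
    then have "eventually (\<lambda>_. False) G" by simp
    then obtain P Q where PQ: "eventually P (filtercomap F (nhds l))" "eventually Q sequentially"
      "\<And>k. P k \<Longrightarrow> Q k \<Longrightarrow> False"
      unfolding G_def eventually_inf by blast
    obtain R where R: "eventually R (nhds l)" "\<And>k. R (F k) \<Longrightarrow> P k"
      using PQ(1) unfolding eventually_filtercomap by blast
    have "eventually (\<lambda>f. \<not> R f) (filtermap F sequentially)"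
      unfolding eventually_filtermap using PQ(2) by (rule eventually_mono) (use PQ(3) R(2) in blast)
    then have "eventually (\<lambda>_. False) (inf (nhds l) (filtermap F sequentially))"
      unfolding eventually_inf using R(1) by blast
    then show False using l by (simp add: eventually_False)
  qed
  moreover have "G \<le> sequentially" unfolding G_def by simp
  moreover have "((\<lambda>k. F k b) \<longlongrightarrow> l b) G" for b
  proof -
    have "G \<le> filtercomap F (nhds l)" unfolding G_def by simp
    then have lim: "filterlim F (nhds l) G"
      by (simp add: filterlim_iff_le_filtercomap)
    show ?thesis
      by (rule continuous_on_tendsto_compose[OF continuous_on_product_coordinates lim]) auto
  qed
  ultimately show thesis by (rule that)
qed

context ruelle_system
begin

definition weighted_series :: "real \<Rightarrow> ('a \<Rightarrow> real) \<Rightarrow> 'a \<Rightarrow> real" where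
  "weighted_series t f x = (\<Sum>n. t ^ n * (L ^^ n) f x)"

lemma iterate_comparison_shift:
  assumes f: "f \<in> Cc_nonneg" and h: "h \<in> Cc_nonneg" and C: "0 \<le> C"
    and le: "\<And>x. (L ^^ N) f x \<le> C * (\<Sum>l\<le>M. (L ^^ l) h x)"
  shows "(L ^^ (n + N)) f x \<le> C * (\<Sum>l\<le>M. (L ^^ (n + l)) h x)"
proof -
  have s: "(\<lambda>x. \<Sum>l\<le>M. (L ^^ l) h x) \<in> Cc_nonneg"
    using h by (intro Cc_nonneg_sum iterate_Cc_nonneg)
  have "(L ^^ (n + N)) f x = (L ^^ n) ((L ^^ N) f) x"
    by (simp add: funpow_add)
  also have "\<dots> \<le> (L ^^ n) (\<lambda>x. C * (\<Sum>l\<le>M. (L ^^ l) h x)) x"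
    by (rule iterate_mono[OF iterate_Cc_nonneg[OF f] Cc_nonneg_scale[OF s C] le])
  also have "\<dots> = C * (\<Sum>l\<le>M. (L ^^ n) ((L ^^ l) h) x)"
    using h by (simp add: iterate_scale iterate_sum iterate_Cc_nonneg)
  also have "\<dots> = C * (\<Sum>l\<le>M. (L ^^ (n + l)) h x)"
    by (simp add: funpow_add)
  finally show ?thesis .
qed

lemma weighted_series_comparison:
  assumes f: "f \<in> Cc_nonneg" and h: "h \<in> Cc_nonneg" and C: "0 \<le> C"
    and le: "\<And>x. (L ^^ N) f x \<le> C * (\<Sum>l\<le>M. (L ^^ l) h x)"
    and t: "1/2 \<le> t" "t \<le> 1" and sm: "summable (\<lambda>n. t ^ n * (L ^^ n) h x)"
  shows "summable (\<lambda>n. t ^ n * (L ^^ n) f x)"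
    and "weighted_series t f x \<le> (\<Sum>n<N. (L ^^ n) f x) + C * 2 ^ M * real (Suc M) * weighted_series t h x"
proof -
  define a where "a n = t ^ n * (L ^^ n) f x" for n
  define b where "b n = t ^ n * (L ^^ n) h x" for n
  have a0: "0 \<le> a n" and b0: "0 \<le> b n" for n
    unfolding a_def b_def using t iterate_nonneg f h by simp_all
  have sb: "summable b" using sm unfolding b_def[abs_def] .
  have pw: "t ^ (n + N) \<le> 2 ^ M * t ^ (n + l)" if "l \<le> M" for n l
  proof -
    have "(1/2) ^ M \<le> (1/2 :: real) ^ l"
      using that by (rule power_decreasing) auto
    also have "\<dots> \<le> t ^ l" using t by (intro power_mono) auto
    finally have "1 \<le> 2 ^ M * t ^ l" by (simp add: power_one_over field_simps)
    then have "t ^ n * 1 \<le> t ^ n * (2 ^ M * t ^ l)" using t by (intro mult_left_mono) auto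
    moreover have "t ^ (n + N) \<le> t ^ n" using t by (intro power_decreasing) auto
    ultimately show ?thesis by (simp add: power_add algebra_simps)
  qed
  have ab: "a (n + N) \<le> C * 2 ^ M * (\<Sum>l\<le>M. b (n + l))" for n
  proof -
    have "a (n + N) \<le> t ^ (n + N) * (C * (\<Sum>l\<le>M. (L ^^ (n + l)) h x))"
      unfolding a_def using t by (intro mult_left_mono iterate_comparison_shift[OF f h C le]) auto
    also have "\<dots> = C * (\<Sum>l\<le>M. t ^ (n + N) * (L ^^ (n + l)) h x)"
      by (simp add: sum_distrib_left mult.left_commute)
    also have "\<dots> \<le> C * (\<Sum>l\<le>M. 2 ^ M * t ^ (n + l) * (L ^^ (n + l)) h x)"
      using C pw iterate_nonneg[OF h] by (intro mult_left_mono sum_mono mult_right_mono) auto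
    also have "\<dots> = C * 2 ^ M * (\<Sum>l\<le>M. b (n + l))"
      by (simp add: b_def sum_distrib_left mult.assoc)
    finally show ?thesis .
  qed
  have sbl: "summable (\<lambda>n. b (n + l))" for l
    using sb by (rule summable_ignore_initial_segment)
  then have ss: "summable (\<lambda>n. C * 2 ^ M * (\<Sum>l\<le>M. b (n + l)))"
    by (intro summable_mult summable_sum)
  have sa': "summable (\<lambda>n. a (n + N))"
    by (rule summable_comparison_test'[OF ss, of 0]) (use ab a0 in auto)
  then have sa: "summable a" by (simp only: summable_iff_shift)
  then show "summable (\<lambda>n. t ^ n * (L ^^ n) f x)" unfolding a_def[abs_def] .
  have le_b: "(\<Sum>n. b (n + l)) \<le> suminf b" for l
    using suminf_split_initial_segment[OF sb, of l] b0 sum_nonneg[of "{..<l}" b] by simp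
  have "suminf a = (\<Sum>n. a (n + N)) + (\<Sum>n<N. a n)"
    by (rule suminf_split_initial_segment[OF sa])
  also have "(\<Sum>n. a (n + N)) \<le> (\<Sum>n. C * 2 ^ M * (\<Sum>l\<le>M. b (n + l)))"
    by (rule suminf_le[OF ab sa' ss])
  also have "\<dots> = C * 2 ^ M * (\<Sum>l\<le>M. \<Sum>n. b (n + l))"
    using sbl by (simp add: suminf_mult summable_sum suminf_sum)
  also have "\<dots> \<le> C * 2 ^ M * (\<Sum>l\<le>M. suminf b)"
    using C le_b by (intro mult_left_mono sum_mono) auto
  also have "\<dots> = C * 2 ^ M * real (Suc M) * suminf b"
    by simp
  also have "(\<Sum>n<N. a n) \<le> (\<Sum>n<N. (L ^^ n) f x)"
    unfolding a_def using t iterate_nonneg[OF f]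
    by (intro sum_mono mult_left_le_one_le) (auto intro: power_le_one)
  finally show "weighted_series t f x \<le> (\<Sum>n<N. (L ^^ n) f x) + C * 2 ^ M * real (Suc M) * weighted_series t h x"
    unfolding weighted_series_def a_def[symmetric] b_def[symmetric] by simp
qed

lemma weighted_series_ruelle:
  assumes "summable (\<lambda>n. t ^ n * (L ^^ n) f x)" "summable (\<lambda>n. t ^ n * (L ^^ n) (L f) x)"
  shows "t * weighted_series t (L f) x = weighted_series t f x - f x"
proof -
  have "t * weighted_series t (L f) x = (\<Sum>n. t ^ Suc n * (L ^^ Suc n) f x)"
    unfolding weighted_series_def suminf_mult[OF assms(2), symmetric]
    by (simp only: power_Suc funpow_Suc_right comp_apply mult.assoc)
  also have "\<dots> = weighted_series t f x - f x"
    unfolding weighted_series_def using suminf_split_head[OF assms(1)] by simp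
  finally show ?thesis .
qed

lemma invariant_functional_exists:
  fixes t :: "nat \<Rightarrow> real" and x :: "nat \<Rightarrow> 'a"
  assumes cof: "cofinal_system \<sigma>" and h: "h \<in> Cc_nonneg" "0 < h z"
    and t: "\<And>k. 1/2 \<le> t k" "\<And>k. t k \<le> 1" "t \<longlonglongrightarrow> 1"
    and sm: "\<And>k. summable (\<lambda>n. t k ^ n * (L ^^ n) h (x k))"
    and pos: "\<And>k. 0 < weighted_series (t k) h (x k)"
    and van: "\<And>f. f \<in> Cc_nonneg \<Longrightarrow> (\<lambda>k. f (x k) / weighted_series (t k) h (x k)) \<longlonglongrightarrow> 0"
  shows "\<exists>T. positive_functional T \<and> T h = 1 \<and> (\<forall>f\<in>Cc_nonneg. T (L f) = T f)"
proof -
  define g where "g k = weighted_series (t k) h (x k)" for k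
  have g: "0 < g k" for k using pos by (simp add: g_def)
  have smf: "summable (\<lambda>n. t k ^ n * (L ^^ n) f (x k))" if f: "f \<in> Cc_nonneg" for f k
  proof -
    obtain N M C where "0 \<le> C" "\<And>x. (L ^^ N) f x \<le> C * (\<Sum>l\<le>M. (L ^^ l) h x)"
      by (rule iterate_comparison[OF cof f h]) (rule that; blast)
    then show ?thesis
      by (rule weighted_series_comparison(1)[OF f h(1) _ _ t(1,2) sm])
  qed
  have W0: "0 \<le> weighted_series (t k) f (x k)" if "f \<in> Cc_nonneg" for f k
  proof -
    have "0 \<le> t k" using t(1)[of k] by simp
    then show ?thesis
      unfolding weighted_series_def using iterate_nonneg[OF that] by (intro suminf_nonneg smf[OF that]) simp
  qed
  define F where "F k f = (if f \<in> Cc_nonneg then weighted_series (t k) f (x k) / g k else 0)" for k f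
  have "\<exists>B. \<forall>k. \<bar>F k f\<bar> \<le> B" for f
  proof (cases "f \<in> Cc_nonneg")
    case False
    then show ?thesis by (auto simp: F_def)
  next
    case f: True
    obtain N M C where C: "0 \<le> C" "\<And>x. (L ^^ N) f x \<le> C * (\<Sum>l\<le>M. (L ^^ l) h x)"
      by (rule iterate_comparison[OF cof f h]) (rule that; blast)
    define D where "D = C * 2 ^ M * real (Suc M)"
    have "(\<lambda>k. \<Sum>n<N. (L ^^ n) f (x k) / g k) \<longlonglongrightarrow> (\<Sum>n<N. 0)"
      unfolding g_def by (intro tendsto_sum van iterate_Cc_nonneg f)
    then have "Bseq (\<lambda>k. \<Sum>n<N. (L ^^ n) f (x k) / g k)"
      by (intro convergent_imp_Bseq) (auto simp: convergent_def)
    then obtain E where E: "\<And>k. \<bar>\<Sum>n<N. (L ^^ n) f (x k) / g k\<bar> \<le> E"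
      unfolding Bseq_def by auto
    have "\<bar>F k f\<bar> \<le> E + D" for k
    proof -
      have "weighted_series (t k) f (x k) \<le> (\<Sum>n<N. (L ^^ n) f (x k)) + D * g k"
        unfolding g_def D_def by (rule weighted_series_comparison(2)[OF f h(1) C t(1,2) sm])
      then have "weighted_series (t k) f (x k) / g k \<le> ((\<Sum>n<N. (L ^^ n) f (x k)) + D * g k) / g k"
        using g[of k] by (intro divide_right_mono) auto
      also have "\<dots> = (\<Sum>n<N. (L ^^ n) f (x k) / g k) + D"
        using g[of k] by (simp add: add_divide_distrib sum_divide_distrib)
      also have "\<dots> \<le> E + D" using E[of k] by simp
      finally show ?thesis
        using W0[OF f, of k] g[of k] f by (simp add: F_def)
    qed
    then show ?thesis by blast
  qed
  then obtain G T where G: "G \<noteq> bot" "G \<le> sequentially" and T: "\<And>f. ((\<lambda>k. F k f) \<longlongrightarrow> T f) G"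
    using bounded_pointwise_cluster_filter[of F] by blast
  have uniq: "T f = c" if "((\<lambda>k. F k f) \<longlongrightarrow> c) G" for f c
    using tendsto_unique[OF G(1) T that] .
  have "positive_functional T"
  proof
    fix f :: "'a \<Rightarrow> real" assume f: "f \<in> Cc_nonneg"
    show "0 \<le> T f"
      by (rule tendsto_lowerbound[OF T _ G(1)]) (use W0[OF f] g f in \<open>auto simp: F_def less_imp_le\<close>)
    fix c :: real assume c: "0 \<le> c"
    have "F k (\<lambda>x. c * f x) = c * F k f" for k
    proof -
      have "weighted_series (t k) (\<lambda>x. c * f x) (x k) = (\<Sum>n. c * (t k ^ n * (L ^^ n) f (x k)))"
        unfolding weighted_series_def by (simp add: iterate_scale mult.left_commute)
      also have "\<dots> = c * weighted_series (t k) f (x k)"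
        unfolding weighted_series_def by (rule suminf_mult[OF smf[OF f]])
      finally show ?thesis
        using f Cc_nonneg_scale[OF f c] by (simp add: F_def)
    qed
    then show "T (\<lambda>x. c * f x) = c * T f"
      using tendsto_mult[OF tendsto_const T] by (intro uniq) simp
  next
    fix f f' :: "'a \<Rightarrow> real" assume f: "f \<in> Cc_nonneg" and f': "f' \<in> Cc_nonneg"
    have "F k (\<lambda>x. f x + f' x) = F k f + F k f'" for k
    proof -
      have "weighted_series (t k) (\<lambda>x. f x + f' x) (x k) =
          (\<Sum>n. t k ^ n * (L ^^ n) f (x k) + t k ^ n * (L ^^ n) f' (x k))"
        unfolding weighted_series_def by (simp add: iterate_add[OF f f'] distrib_left)
      also have "\<dots> = weighted_series (t k) f (x k) + weighted_series (t k) f' (x k)"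
        unfolding weighted_series_def by (rule suminf_add[OF smf[OF f] smf[OF f'], symmetric])
      finally show ?thesis
        using f f' Cc_nonneg_add[OF f f'] by (simp add: F_def add_divide_distrib)
    qed
    then show "T (\<lambda>x. f x + f' x) = T f + T f'"
      using tendsto_add[OF T T] by (intro uniq) simp
  qed
  moreover have "T h = 1"
  proof (rule uniq)
    have "F k h = 1" for k using g[of k] h(1) by (simp add: F_def g_def)
    then show "((\<lambda>k. F k h) \<longlongrightarrow> 1) G" by simp
  qed
  moreover have "T (L f) = T f" if f: "f \<in> Cc_nonneg" for f
  proof -
    have eq: "F k f = t k * F k (L f) + f (x k) / g k" for k
    proof -
      have "t k * weighted_series (t k) (L f) (x k) = weighted_series (t k) f (x k) - f (x k)"
        by (rule weighted_series_ruelle[OF smf[OF f] smf[OF ruelle_Cc_nonneg[OF f]]])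
      then have "weighted_series (t k) f (x k) = t k * weighted_series (t k) (L f) (x k) + f (x k)"
        by simp
      then show ?thesis
        using f ruelle_Cc_nonneg[OF f] by (simp add: F_def add_divide_distrib)
    qed
    have "((\<lambda>k. t k * F k (L f) + f (x k) / g k) \<longlongrightarrow> 1 * T (L f) + 0) G"
      using tendsto_mono[OF G(2) t(3)] tendsto_mono[OF G(2) van[OF f]] T
      unfolding g_def by (intro tendsto_add tendsto_mult)
    then have "T f = 1 * T (L f) + 0"
      unfolding eq[symmetric] by (rule uniq)
    then show ?thesis by simp
  qed
  ultimately show ?thesis by blast
qed

end

lemma root_le_imp_le_power:
  assumes "root n a \<le> r" "0 \<le> a" "0 < n"
  shows "a \<le> r ^ n"
proof -
  have "a = root n a ^ n" using assms(2,3) by simp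
  also have "\<dots> \<le> r ^ n" using assms by (intro power_mono) auto
  finally show ?thesis .
qed

lemma ln_ext_le_zero:
  assumes "ln_ext r \<le> 0"
  shows "r \<le> 1"
proof (cases r)
  case (real s)
  then show ?thesis
    using assms by (cases "s \<le> 0") (auto simp: ln_ext_def)
qed (use assms in \<open>auto simp: ln_ext_def\<close>)

context ruelle_system
begin

abbreviation growth :: "('a \<Rightarrow> real) \<Rightarrow> 'a \<Rightarrow> ereal" where
  "growth f x \<equiv> limsup (\<lambda>n. ereal (root n ((L ^^ n) f x)))"

lemma growth_nonneg:
  assumes "f \<in> Cc_nonneg"
  shows "0 \<le> growth f x"
  using iterate_nonneg[OF assms] by (intro le_Limsup) (auto simp: real_root_ge_zero)

lemma growth_less_imp:
  assumes f: "f \<in> Cc_nonneg" and less: "growth f x < ereal r"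
  obtains n0 where "\<And>n. n0 \<le> n \<Longrightarrow> (L ^^ n) f x \<le> r ^ n"
proof -
  have "eventually (\<lambda>n. ereal (root n ((L ^^ n) f x)) < ereal r) sequentially"
    using Limsup_lessD[OF less] .
  then obtain n0 where n0: "\<And>n. n0 \<le> n \<Longrightarrow> root n ((L ^^ n) f x) < r"
    unfolding eventually_sequentially by auto
  have "(L ^^ n) f x \<le> r ^ n" if "Suc n0 \<le> n" for n
    by (rule root_le_imp_le_power[OF _ iterate_nonneg[OF f]]) (use n0[of n] that in auto)
  then show thesis by (rule that)
qed

lemma growth_le:
  assumes cof: "cofinal_system \<sigma>" and f: "f \<in> Cc_nonneg" and h: "h \<in> Cc_nonneg" "0 < h z"
  shows "growth f x \<le> growth h x"
proof (rule dense_ge)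
  fix y assume y: "growth h x < y"
  show "growth f x \<le> y"
  proof (cases y)
    case (real r)
    have r: "0 < r"
      using le_less_trans[OF growth_nonneg[OF h(1)] y] real by simp
    obtain n0 where n0: "\<And>n. n0 \<le> n \<Longrightarrow> (L ^^ n) h x \<le> r ^ n"
      by (rule growth_less_imp[OF h(1) y[unfolded real]]) (rule that; blast)
    obtain N M C where C: "0 \<le> C" "\<And>x. (L ^^ N) f x \<le> C * (\<Sum>l\<le>M. (L ^^ l) h x)"
      by (rule iterate_comparison[OF cof f h]) (rule that; blast)
    define D where "D = max 1 (C * (\<Sum>l\<le>M. r ^ l) / r ^ N)"
    have D: "0 < D" by (simp add: D_def)
    have bd: "(L ^^ n) f x \<le> D * r ^ n" if n: "n0 + N \<le> n" for n
    proof -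
      define k where "k = n - N"
      have k: "n = k + N" "n0 \<le> k" using n by (simp_all add: k_def)
      have "(L ^^ n) f x \<le> C * (\<Sum>l\<le>M. (L ^^ (k + l)) h x)"
        unfolding k(1) by (rule iterate_comparison_shift[OF f h(1) C])
      also have "\<dots> \<le> C * (\<Sum>l\<le>M. r ^ (k + l))"
        using C(1) n0 k(2) by (intro mult_left_mono sum_mono) auto
      also have "\<dots> = C * (\<Sum>l\<le>M. r ^ l) / r ^ N * r ^ n"
        using r k(1) by (simp add: power_add sum_distrib_left[symmetric])
      also have "\<dots> \<le> D * r ^ n"
        using r by (intro mult_right_mono) (auto simp: D_def)
      finally show ?thesis .
    qed
    have "root n ((L ^^ n) f x) \<le> root n D * r" if n: "Suc (n0 + N) \<le> n" for n
    proof -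
      have "root n ((L ^^ n) f x) \<le> root n (D * r ^ n)"
        using n bd by (intro real_root_le_mono) auto
      also have "\<dots> = root n D * r"
        using n r by (simp add: real_root_mult real_root_power_cancel)
      finally show ?thesis .
    qed
    then have "growth f x \<le> limsup (\<lambda>n. ereal (root n D * r))"
      by (intro Limsup_mono eventually_sequentiallyI[of "Suc (n0 + N)"]) auto
    also have "\<dots> = ereal (1 * r)"
      by (intro lim_imp_Limsup tendsto_ereal tendsto_mult tendsto_const LIMSEQ_root_const D) simp
    finally show ?thesis using real by simp
  qed (use y in auto)
qed

lemma pressure_at_eq:
  assumes cof: "cofinal_system \<sigma>" and h: "h \<in> Cc_nonneg" "0 < h z"
  shows "pressure_at \<sigma> \<psi> x = ruelle_growth \<sigma> \<psi> h x"
proof -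
  have hp: "h \<in> Cc_pos"
    using h unfolding Cc_pos_def Cc_nonneg_iff by (auto intro: exI[of _ z])
  have eq: "ruelle_growth \<sigma> \<psi> f x = ruelle_growth \<sigma> \<psi> h x" if f: "f \<in> Cc_pos" for f
  proof -
    have f': "f \<in> Cc_nonneg"
      using f by (simp add: Cc_pos_def Cc_nonneg_iff)
    obtain y where "f y \<noteq> 0" "0 \<le> f y" using f unfolding Cc_pos_def by blast
    then have "0 < f y" by simp
    then have "growth f x = growth h x"
      using growth_le[OF cof f' h] growth_le[OF cof h(1) f'] by (intro antisym)
    then show ?thesis by (simp add: ruelle_growth_def)
  qed
  show ?thesis
    unfolding pressure_at_def
  proof (rule the_equality)
    show "\<forall>f\<in>Cc_pos. ruelle_growth \<sigma> \<psi> f x = ruelle_growth \<sigma> \<psi> h x"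
      by (rule ballI, rule eq)
    show "p = ruelle_growth \<sigma> \<psi> h x" if "\<forall>f\<in>Cc_pos. ruelle_growth \<sigma> \<psi> f x = p" for p
      using bspec[OF that hp] by (rule sym)
  qed
qed

lemma summable_of_pressure:
  assumes cof: "cofinal_system \<sigma>" and p: "pressure \<sigma> \<psi> \<le> 0"
    and h: "h \<in> Cc_nonneg" "0 < h z" and t: "0 < t" "t < 1"
  shows "summable (\<lambda>n. t ^ n * (L ^^ n) h x)"
proof -
  have "pressure_at \<sigma> \<psi> x \<le> pressure \<sigma> \<psi>"
    unfolding pressure_def by (rule SUP_upper) simp
  then have "ruelle_growth \<sigma> \<psi> h x \<le> 0"
    using p unfolding pressure_at_eq[OF cof h] by (rule order_trans)
  then have g1: "growth h x \<le> 1"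
    unfolding ruelle_growth_def by (rule ln_ext_le_zero)
  define r where "r = (1 + 1 / t) / 2"
  have r: "1 < r" "t * r < 1" "0 < t * r"
    using t by (simp_all add: r_def field_simps add_pos_pos)
  have "growth h x < ereal r"
    using g1 by (rule le_less_trans) (simp add: r one_ereal_def)
  then obtain n0 where n0: "\<And>n. n0 \<le> n \<Longrightarrow> (L ^^ n) h x \<le> r ^ n"
    by (rule growth_less_imp[OF h(1)]) (rule that; blast)
  have bd: "norm (t ^ n * (L ^^ n) h x) \<le> (t * r) ^ n" if "n0 \<le> n" for n
  proof -
    have "t ^ n * (L ^^ n) h x \<le> t ^ n * r ^ n"
      using t n0[OF that] by (intro mult_left_mono) auto
    then show ?thesis
      using t iterate_nonneg[OF h(1), of n x] by (simp add: power_mult_distrib)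
  qed
  have "summable (\<lambda>n. (t * r) ^ n)"
    using r by (intro summable_geometric) simp
  then show ?thesis
    using bd by (rule summable_comparison_test')
qed

lemma invariant_functional_recurrent:
  assumes cof: "cofinal_system \<sigma>" and p: "pressure \<sigma> \<psi> \<le> 0"
    and h: "h \<in> Cc_nonneg" "0 < h z" and ns: "\<not> summable (\<lambda>n. (L ^^ n) h x)"
  shows "\<exists>T. positive_functional T \<and> T h = 1 \<and> (\<forall>f\<in>Cc_nonneg. T (L f) = T f)"
proof -
  define t where "t k = 1 - inverse (real (Suc (Suc k)))" for k
  have t: "1/2 \<le> t k" "t k < 1" "0 < t k" for k
    by (auto simp: t_def field_simps)
  have tl: "t \<longlonglongrightarrow> 1"
  proof -
    have "t \<longlonglongrightarrow> 1 - 0"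
      unfolding t_def[abs_def]
      by (intro tendsto_diff tendsto_const LIMSEQ_Suc[OF LIMSEQ_inverse_real_of_nat])
    then show ?thesis by simp
  qed
  have sm: "summable (\<lambda>n. t k ^ n * (L ^^ n) h x)" for k
    by (rule summable_of_pressure[OF cof p h t(3,2)])
  have nn: "0 \<le> t k ^ n * (L ^^ n) h x" for k n
    using t(3)[of k] iterate_nonneg[OF h(1)] by simp
  have partial: "(\<Sum>i<n. t k ^ i * (L ^^ i) h x) \<le> weighted_series (t k) h x" for k n
    unfolding weighted_series_def using nn by (intro sum_le_suminf sm) auto
  have unbounded: "\<exists>n. Z < (\<Sum>i<n. (L ^^ i) h x)" for Z
  proof (rule ccontr)
    assume "\<nexists>n. Z < (\<Sum>i<n. (L ^^ i) h x)"
    then have "summable (\<lambda>n. (L ^^ n) h x)"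
      using iterate_nonneg[OF h(1)] by (intro summableI_nonneg_bounded[of _ Z]) (auto simp: not_less)
    then show False using ns by simp
  qed
  have pos: "0 < weighted_series (t k) h x" for k
  proof -
    obtain n where "0 < (\<Sum>i<n. (L ^^ i) h x)" using unbounded by blast
    then obtain i where i: "0 < (L ^^ i) h x"
      using sum_nonpos[of "{..<n}" "\<lambda>i. (L ^^ i) h x"] by (meson linorder_not_less)
    show ?thesis
      unfolding weighted_series_def
      by (rule suminf_pos2[OF sm nn, of _ i]) (use i t(3)[of k] in simp)
  qed
  have "filterlim (\<lambda>k. weighted_series (t k) h x) at_top sequentially"
    unfolding filterlim_at_top
  proof
    fix Z :: real
    obtain n where n: "Z < (\<Sum>i<n. (L ^^ i) h x)" using unbounded by blast
    have "(\<lambda>k. \<Sum>i<n. t k ^ i * (L ^^ i) h x) \<longlonglongrightarrow> (\<Sum>i<n. 1 ^ i * (L ^^ i) h x)"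
      by (intro tendsto_sum tendsto_mult tendsto_power tendsto_const tl)
    then have "eventually (\<lambda>k. Z < (\<Sum>i<n. t k ^ i * (L ^^ i) h x)) sequentially"
      by (rule order_tendstoD(1)) (use n in simp)
    then show "eventually (\<lambda>k. Z \<le> weighted_series (t k) h x) sequentially"
      by (rule eventually_mono) (use partial less_le_trans less_imp_le in blast)
  qed
  then have inf: "filterlim (\<lambda>k. weighted_series (t k) h x) at_infinity sequentially"
    by (rule filterlim_at_top_imp_at_infinity)
  have "(\<lambda>k. f x / weighted_series (t k) h x) \<longlonglongrightarrow> 0" for f :: "'a \<Rightarrow> real"
    by (rule tendsto_divide_0[OF tendsto_const inf])
  then show ?thesis
    using invariant_functional_exists[OF cof h t(1) less_imp_le[OF t(2)] tl, of "\<lambda>_. x"] sm pos by blast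
qed

lemma invariant_functional_transient:
  fixes Q :: "nat \<Rightarrow> 'a set"
  assumes cof: "cofinal_system \<sigma>" and nc: "noncompact_system \<sigma>"
    and h: "h \<in> Cc_nonneg" "0 < h z" and sm: "\<And>x. summable (\<lambda>n. (L ^^ n) h x)"
    and Q: "\<And>n. compact (Q n)" "incseq Q" "\<And>K. compact K \<Longrightarrow> \<exists>n. K \<subseteq> Q n"
  shows "\<exists>T. positive_functional T \<and> T h = 1 \<and> (\<forall>f\<in>Cc_nonneg. T (L f) = T f)"
proof -
  define U where "U = {x. 0 < h x}"
  have U: "open U" "U \<noteq> {}"
    using h Cc_nonnegD(1)[OF h(1)] by (auto simp: U_def intro: open_Collect_less)
  have "\<exists>x. x \<in> (\<Union>k. (\<sigma> ^^ k) ` U) \<and> x \<notin> Q n" for n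
  proof (rule ccontr)
    assume "\<nexists>x. x \<in> (\<Union>k. (\<sigma> ^^ k) ` U) \<and> x \<notin> Q n"
    then have "(\<Union>k. (\<sigma> ^^ k) ` U) \<subseteq> Q n" by blast
    then have "closure (\<Union>k. (\<sigma> ^^ k) ` U) \<subseteq> Q n"
      using Q(1) by (intro closure_minimal compact_imp_closed)
    then have "compact (closure (\<Union>k. (\<sigma> ^^ k) ` U))"
      by (metis Q(1) closed_closure compact_Int_closed inf.absorb_iff2)
    then show False
      using nc U unfolding noncompact_system_def by blast
  qed
  then obtain x where x: "\<And>n. x n \<in> (\<Union>k. (\<sigma> ^^ k) ` U)" "\<And>n. x n \<notin> Q n"
    by metis
  have sm1: "summable (\<lambda>n. 1 ^ n * (L ^^ n) h y)" for y
    using sm by simp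
  have pos: "0 < weighted_series 1 h (x n)" for n
  proof -
    obtain k u where "0 < h u" "(\<sigma> ^^ k) u = x n"
      using x(1)[of n] unfolding U_def by fastforce
    then have "0 < (L ^^ k) h (x n)"
      using iterate_pos_iff[OF h(1)] by blast
    then show ?thesis
      unfolding weighted_series_def using iterate_nonneg[OF h(1)]
      by (intro suminf_pos2[OF sm1, of _ k]) auto
  qed
  have van: "(\<lambda>n. f (x n) / weighted_series 1 h (x n)) \<longlonglongrightarrow> 0" if f: "f \<in> Cc_nonneg" for f
  proof -
    obtain K where K: "compact K" "\<And>y. y \<notin> K \<Longrightarrow> f y = 0"
      using f by (metis Cc_nonneg_compact_support)
    obtain n0 where n0: "K \<subseteq> Q n0" using Q(3)[OF K(1)] by blast
    have "f (x n) / weighted_series 1 h (x n) = 0" if "n0 \<le> n" for n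
    proof -
      have "K \<subseteq> Q n" using n0 incseqD[OF Q(2) that] by blast
      then show ?thesis using x(2)[of n] K(2) by auto
    qed
    then show ?thesis
      by (intro tendsto_eventually eventually_sequentiallyI)
  qed
  show ?thesis
    by (rule invariant_functional_exists[OF cof h, where t = "\<lambda>_. 1" and x = x])
      (use sm1 pos van in simp_all)
qed

end

theorem theorem4p4:
  fixes \<sigma> :: "'a::{t2_space, second_countable_topology} \<Rightarrow> 'a"
    and \<phi> h :: "'a \<Rightarrow> real"
  assumes "locally_compact_space (euclidean :: 'a topology)"
    and "local_homeomorphism \<sigma>"
    and "continuous_on UNIV \<phi>"
    and "cofinal_system \<sigma>"
    and "noncompact_system \<sigma>"
    and "pressure \<sigma> (\<lambda>x. - \<phi> x) \<le> 0"
    and "h \<in> Cc" and "\<forall>x. 0 \<le> h x" and "\<exists>x. h x \<noteq> 0"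
  shows "\<exists>m. conformal_measure \<sigma> \<phi> m \<and> (\<integral>x. h x \<partial>m) = 1"
proof -
  have sys: "ruelle_system \<sigma> (\<lambda>x. - \<phi> x)"
    using assms(1-3) by unfold_locales (auto intro: continuous_intros)
  interpret ruelle_system \<sigma> "\<lambda>x. - \<phi> x" by (rule sys)
  have h: "h \<in> Cc_nonneg" using assms(7,8) by (simp add: Cc_nonneg_iff)
  obtain z where z: "0 < h z" using assms(8,9) by (metis order_le_less)
  obtain Q :: "nat \<Rightarrow> 'a set" where Q: "\<And>n. compact (Q n)" "incseq Q" "\<And>K. compact K \<Longrightarrow> \<exists>n. K \<subseteq> Q n"
    by (rule compact_exhaustion[OF lc]) (rule that; (assumption | blast))
  have "\<exists>T. positive_functional T \<and> T h = 1 \<and> (\<forall>f\<in>Cc_nonneg. T (L f) = T f)"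
  proof (cases "\<forall>x. summable (\<lambda>n. (L ^^ n) h x)")
    case True
    then show ?thesis
      by (intro invariant_functional_transient[OF assms(4,5) h z _ Q]) simp_all
  next
    case False
    then obtain x where "\<not> summable (\<lambda>n. (L ^^ n) h x)" by blast
    then show ?thesis
      by (rule invariant_functional_recurrent[OF assms(4,6) h z])
  qed
  then obtain T where T: "positive_functional T" "T h = 1" "\<And>f. f \<in> Cc_nonneg \<Longrightarrow> T (L f) = T f"
    by blast
  obtain m where m: "regular_borel_measure m" "\<And>f. f \<in> Cc_nonneg \<Longrightarrow> (\<integral>x. f x \<partial>m) = T f"
    using positive_functional.riesz_representation[OF T(1) lc] by blast
  have int_h: "(\<integral>x. h x \<partial>m) = 1"
    using m(2)[OF h] T(2) by simp
  have "emeasure m UNIV \<noteq> 0"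
  proof
    assume "emeasure m UNIV = 0"
    then have "UNIV \<in> null_sets m"
      using regular_borel_measure_sets[OF m(1)] by (intro null_setsI) auto
    then have "AE x in m. h x = 0"
      by (rule AE_I') auto
    then have "(\<integral>x. h x \<partial>m) = 0"
      by (rule integral_eq_zero_AE)
    then show False using int_h by simp
  qed
  then have "conformal_measure \<sigma> \<phi> m"
    using m T(3) by (intro conformal_if_invariant[OF sys m(1)]) (simp_all add: ruelle_Cc_nonneg)
  then show ?thesis
    using int_h by blast
qed

end
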